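(* Let $$\phi_n=\mathbb 1\big\{\Pi\big(d_1(g,\mathcal F^* )\le M_n n^{-1/(2+d)}\,\big|\,\mathbb D_n\big)<\gamma\big\},$$ where $M_n$ is a slowly growing sequence ($M_n\to\infty$ with $M_n=o(n^{\delta})$ for every $\delta>0$) and $\gamma\in(0,1)$ is a predetermined constant. If $J\asymp n^{1/(2+d)}$, then: (i) for any fixed $g_0\in\mathcal G^*$, $\mathrm E_0(\phi_n)\to0$; (ii) for any fixed density $g_0$ not in the $\mathbb L_1$-closure of $\mathcal G^*$, $\mathrm E_0(1-\phi_n)\to0$; (iii) for any $\alpha\in(0,1]$ and any $L>0$, $$\sup\{\mathrm E_0(1-\phi_n): g_0\in\mathcal H(\alpha,L),\ d_1(g_0,\mathcal G^* )>\rho_n(\alpha)\}\to0,$$ where $\rho_n(\alpha)=Cn^{-\alpha/(2+d)}$ for some $C>0$ if $\alpha<1$, and $\rho_n(\alpha)=CM_nn^{-1/(2+d)}$ for any $C>2$ if $\alpha=1$.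
   Context: Data: $\mathbb{D}_n=(\boldsymbol{X}_1,\dots,\boldsymbol{X}_n)$ are i.i.d. from a probability density on $[0,1]^d$; $g_0$ is the true density, and $\mathrm E_0$ is expectation under $g_0$. Write $\boldsymbol{x}\succeq\boldsymbol{y}$ iff $x_k\ge y_k$ for all $k$. $\mathcal F^*$ is the set of $f:[0,1]^d\to\mathbb R$ with $f(\boldsymbol x)\le f(\boldsymbol y)$ whenever $\boldsymbol x\succeq\boldsymbol y$; $\mathcal{G}^*$ is the set of $g\in\mathcal F^*$ with $g\ge0$ and $\int g=1$. $\mathcal H(\alpha,L)$ is the class of Hölder continuous functions on $[0,1]^d$ with Hölder smoothness index $\alpha$ and Hölder constant $L$ (for $\alpha\in(0,1]$: $|f(\boldsymbol x)-f(\boldsymbol y)|\le L\|\boldsymbol x-\boldsymbol y\|^\alpha$); in the supremum $g_0$ ranges over probability densities in this class. $d_1(f,\mathcal S)=\inf\{\|f-s\|_1:s\in\mathcal S\}$ with the $\mathbb L_1$-norm on $[0,1]^d$. $\asymp$ means equality in order. $\mathbb 1$ denotes an indicator. Prior and posterior: $J$ is a deterministic positive integer depending on $n$, $\mathbf 1$ is the all-one vector, $\boldsymbol{J}=(J,\dots,J)$, $[\mathbf 1:\boldsymbol J]=\{\boldsymbol j\in\mathbb Z_{>0}^d:1\le j_k\le J\text{ for all }k\}$; $I_{\mathbf 1}=[0,1/J]^d$ and $I_{\boldsymbol j}=\prod_{k=1}^d((j_k-1)/J,j_k/J]$ for $\boldsymbol j\in[\mathbf 1:\boldsymbol J]$,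 $\boldsymbol j\ne\mathbf 1$. The random density is $g=J^d\sum_{\boldsymbol j\in[\mathbf 1:\boldsymbol J]}\theta_{\boldsymbol j}\mathbb 1_{I_{\boldsymbol j}}$ with Dirichlet prior $(\theta_{\boldsymbol j})\sim\mathrm{Dir}(J^d;(\alpha_{\boldsymbol j}))$ for some array of positive numbers $(\alpha_{\boldsymbol j}:\boldsymbol j\in[\mathbf 1:\boldsymbol J])$. The (unrestricted) posterior $\Pi(\cdot|\mathbb D_n)$ of $g$ is given by $(\theta_{\boldsymbol j})|\mathbb D_n\sim\mathrm{Dir}(J^d;(\alpha_{\boldsymbol j}+N_{\boldsymbol j}))$, where $N_{\boldsymbol j}=\sum_{i=1}^n\mathbb 1_{I_{\boldsymbol j}}(\boldsymbol X_i)$.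
   Formalization: The prior parameters are additionally assumed to satisfy (sum over j of alpha_j)/n = o(M_n n^{-1/(2+d)}), as holds for bounded arrays; for arbitrary positive arrays (e.g. all alpha_j = e^n) claim (ii) fails. *)

theory Defs
  imports "HOL-Analysis.Analysis" "HOL-Library.Landau_Symbols"
begin

text \<open>
  Points of $[0,1]^d$ are vectors of type \<^typ>\<open>real ^ 'd\<close> with $d$ = \<open>CARD('d)\<close>. Functions on the
  cube are total functions on \<^typ>\<open>real ^ 'd\<close> whose values outside the cube are never looked at.
  The order \<open>\<le>\<close> on vectors is the componentwise one. Integrals are Lebesgue integrals over the
  completed Lebesgue measure, since a coordinatewise monotone function need not be Borel measurable.
\<close>

definition unit_cube :: "(real ^ 'd) set" where
  "unit_cube = {x. \<forall>k. 0 \<le> x $ k \<and> x $ k \<le> 1}"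

definition L1_norm :: "(real ^ 'd \<Rightarrow> real) \<Rightarrow> real" where
  "L1_norm f = (LINT x|lebesgue_on unit_cube. \<bar>f x\<bar>)"

definition d1 :: "(real ^ 'd \<Rightarrow> real) \<Rightarrow> (real ^ 'd \<Rightarrow> real) set \<Rightarrow> real" where
  "d1 f S = (INF s\<in>S. L1_norm (\<lambda>x. f x - s x))"

definition L1_closure :: "(real ^ 'd \<Rightarrow> real) set \<Rightarrow> (real ^ 'd \<Rightarrow> real) set" where
  "L1_closure S = {f. integrable (lebesgue_on unit_cube) f \<and>
     (\<forall>e>0. \<exists>s\<in>S. L1_norm (\<lambda>x. f x - s x) < e)}"

definition densities :: "(real ^ 'd \<Rightarrow> real) set" where
  "densities = {g. integrable (lebesgue_on unit_cube) g \<and> (\<forall>x\<in>unit_cube. 0 \<le> g x) \<and>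
     (LINT x|lebesgue_on unit_cube. g x) = 1}"

text \<open>No measurability is imposed here: coordinatewise decreasing functions on the cube are
  automatically bounded and Lebesgue measurable.\<close>

definition Fstar :: "(real ^ 'd \<Rightarrow> real) set" where
  "Fstar = {f. \<forall>x\<in>unit_cube. \<forall>y\<in>unit_cube. y \<le> x \<longrightarrow> f x \<le> f y}"

definition Gstar :: "(real ^ 'd \<Rightarrow> real) set" where
  "Gstar = {g \<in> Fstar. (\<forall>x\<in>unit_cube. 0 \<le> g x) \<and> (LINT x|lebesgue_on unit_cube. g x) = 1}"

definition holder :: "real \<Rightarrow> real \<Rightarrow> (real ^ 'd \<Rightarrow> real) set" where
  "holder \<alpha> L = {f. \<forall>x\<in>unit_cube. \<forall>y\<in>unit_cube. \<bar>f x - f y\<bar> \<le> L * norm (x - y) powr \<alpha>}"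

definition grid :: "nat \<Rightarrow> (nat ^ 'd) set" where
  "grid J = {j. \<forall>k. 1 \<le> j $ k \<and> j $ k \<le> J}"

text \<open>Here \<open>1 :: nat ^ 'd\<close> is the all-one vector.\<close>

definition cell :: "nat \<Rightarrow> nat ^ 'd \<Rightarrow> (real ^ 'd) set" where
  "cell J j = (if j = 1 then {x. \<forall>k. 0 \<le> x $ k \<and> x $ k \<le> 1 / real J}
     else {x. \<forall>k. (real (j $ k) - 1) / real J < x $ k \<and> x $ k \<le> real (j $ k) / real J})"

definition histogram :: "nat \<Rightarrow> (nat ^ 'd \<Rightarrow> real) \<Rightarrow> real ^ 'd \<Rightarrow> real" where
  "histogram J \<theta> x = real J ^ CARD('d) * (\<Sum>j\<in>grid J. \<theta> j * indicator (cell J j) x)"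

text \<open>
  The Dirichlet distribution on the simplex over a finite index set \<open>I\<close>: the coordinates other than
  \<open>i0 \<in> I\<close> have the usual density with respect to Lebesgue measure, and coordinate \<open>i0\<close> is one minus
  their sum. The law does not depend on the choice of \<open>i0\<close>; for \<open>I = {i0}\<close> it is the point mass at 1.
\<close>

definition dirichlet_density :: "'i set \<Rightarrow> 'i \<Rightarrow> ('i \<Rightarrow> real) \<Rightarrow> ('i \<Rightarrow> real) \<Rightarrow> real" where
  "dirichlet_density I i0 a x =
     (if (\<forall>i\<in>I - {i0}. 0 < x i) \<and> (\<Sum>i\<in>I - {i0}. x i) < 1
      then Gamma (\<Sum>i\<in>I. a i) / (\<Prod>i\<in>I. Gamma (a i)) *
           (\<Prod>i\<in>I - {i0}. x i powr (a i - 1)) * (1 - (\<Sum>i\<in>I - {i0}. x i)) powr (a i0 - 1)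
      else 0)"

definition dirichlet :: "'i set \<Rightarrow> 'i \<Rightarrow> ('i \<Rightarrow> real) \<Rightarrow> ('i \<Rightarrow> real) measure" where
  "dirichlet I i0 a =
     distr (density (\<Pi>\<^sub>M i\<in>I - {i0}. lborel) (\<lambda>x. ennreal (dirichlet_density I i0 a x)))
       (\<Pi>\<^sub>M i\<in>I. borel) (\<lambda>x. x(i0 := 1 - (\<Sum>i\<in>I - {i0}. x i)))"

text \<open>The sample $X_1,\dots,X_n$ is represented as \<open>X 0, \<dots>, X (n - 1)\<close>.\<close>

definition cell_count :: "nat \<Rightarrow> nat \<Rightarrow> (nat \<Rightarrow> real ^ 'd) \<Rightarrow> nat ^ 'd \<Rightarrow> real" where
  "cell_count n J X j = (\<Sum>i<n. indicator (cell J j) (X i))"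

text \<open>The posterior law of the coefficients under the prior \<open>dirichlet (grid J) 1 a\<close>, and the induced
  posterior probability that the random density \<open>g\<close> lies in \<open>A\<close>.\<close>

definition posterior ::
    "nat \<Rightarrow> nat \<Rightarrow> (nat ^ 'd \<Rightarrow> real) \<Rightarrow> (nat \<Rightarrow> real ^ 'd) \<Rightarrow> (nat ^ 'd \<Rightarrow> real) measure" where
  "posterior n J a X = dirichlet (grid J) 1 (\<lambda>j. a j + cell_count n J X j)"

definition posterior_prob ::
    "nat \<Rightarrow> nat \<Rightarrow> (nat ^ 'd \<Rightarrow> real) \<Rightarrow> (nat \<Rightarrow> real ^ 'd) \<Rightarrow> (real ^ 'd \<Rightarrow> real) set \<Rightarrow> real" where
  "posterior_prob n J a X A =
     measure (posterior n J a X) {\<theta> \<in> space (posterior n J a X). histogram J \<theta> \<in> A}"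

definition mono_test ::
    "nat \<Rightarrow> nat \<Rightarrow> (nat ^ 'd \<Rightarrow> real) \<Rightarrow> real \<Rightarrow> real \<Rightarrow> (nat \<Rightarrow> real ^ 'd) \<Rightarrow> real" where
  "mono_test n J a r \<gamma> X = of_bool (posterior_prob n J a X {g. d1 g Fstar \<le> r} < \<gamma>)"

text \<open>The joint law of $n$ i.i.d. observations with density \<open>g0\<close>, and expectation under it.\<close>

definition data_law :: "nat \<Rightarrow> (real ^ 'd \<Rightarrow> real) \<Rightarrow> (nat \<Rightarrow> real ^ 'd) measure" where
  "data_law n g0 = (\<Pi>\<^sub>M i\<in>{..<n}. density (lebesgue_on unit_cube) (\<lambda>x. ennreal (g0 x)))"

definition E0 :: "nat \<Rightarrow> (real ^ 'd \<Rightarrow> real) \<Rightarrow> ((nat \<Rightarrow> real ^ 'd) \<Rightarrow> real) \<Rightarrow> real" where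
  "E0 n g0 h = (LINT X|data_law n g0. h X)"

end

theory Submission
  imports Defs "HOL-Probability.Probability" "HOL-Real_Asymp.Real_Asymp"
begin

text \<open>
  The posterior concentrates, uniformly over all true densities $g_0$, around the cellwise average
  $P g_0$ of $g_0$ at the rate $\epsilon_n = n^{-1/(2+d)}$, up to a prior term that is $o(M_n \epsilon_n)$;
  the rest is approximation theory and the triangle inequality for \<^term>\<open>d1\<close>.
  
  Write $p_j$ for the $g_0$-mass of cell $j$ and $A$ for the total mass of the prior parameters. Two step
  functions with weights $\theta$ and $\theta'$ are at $L_1$-distance at most $\sum_j |\theta_j - \theta'_j|$.
  A Dirichlet coordinate with mean $m_j$ and total mass $A + n$ has variance at most $m_j / n$, and the
  cell frequencies $N_j / n$ have variance at most $p_j / n$; by Cauchy-Schwarz over the $J^d$ cells each of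
  these two errors sums to at most $\sqrt{J^d / n}$, which is of order $\epsilon_n$ because
  $J \asymp n^{1/(2+d)}$. The prior shifts the posterior mean by at most $2A/n = o(M_n \epsilon_n)$. So
  $\sum_j |\theta_j - p_j|$ exceeds a fixed multiple of $M_n \epsilon_n$ with posterior probability that
  is small in expectation (\<open>dirichlet_tail\<close>, \<open>posterior_tail\<close>, \<open>E0_le_risk_bound\<close>).
  
  If $g_0$ is decreasing, then $\|g_0 - P g_0\|_1 \le d (g_0(0) - g_0(1)) / J$: on each diagonal of cells
  the oscillations of $g_0$ telescope (\<open>L1_projection_Fstar\<close>). This is $O(\epsilon_n)$, so the
  posterior concentrates within $M_n \epsilon_n$ of the decreasing functions and rejections become unlikely
  (\<open>false_rejection_le\<close>). If $g_0$ is at distance more than $C M_n \epsilon_n$ from the decreasing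
  densities, then it is at distance more than $(C/2) M_n \epsilon_n$ from the decreasing functions: the positive
  part of a decreasing function can be normalised to a density at the price of a factor two
  (\<open>d1_Gstar_le\<close>), which is where the bound $C > 2$ comes from. Subtracting the approximation error
  $\|g_0 - P g_0\|_1$ and the tolerance $M_n \epsilon_n$ still leaves a multiple of $M_n \epsilon_n$ that
  $\sum_j |\theta_j - p_j|$ must bridge before the test accepts (\<open>false_acceptance_le\<close>). The
  approximation error is $O(\epsilon_n^\alpha)$ under a Hoelder condition and tends to $0$ for every fixed
  integrable $g_0$ by density of the continuous functions (\<open>L1_projection_tendsto\<close>).
\<close>

section \<open>Moments and tails of the Dirichlet distribution\<close>

lemma nn_integral_beta_scaled:
  fixes p q s :: real
  assumes "0 < p" "0 < q" "0 < s"
  shows "(\<integral>\<^sup>+t. ennreal (if 0 < t \<and> t < s then t powr (p - 1) * (s - t) powr (q - 1) else 0) \<partial>lborel)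
    = ennreal (Beta p q * s powr (p + q - 1))"
proof -
  define f where "f = (\<lambda>t::real. if 0 < t \<and> t < s then t powr (p - 1) * (s - t) powr (q - 1) else 0)"
  define g where "g = (\<lambda>t::real. if 0 < t \<and> t < 1 then t powr (p - 1) * (1 - t) powr (q - 1) else 0)"
  have [measurable]: "f \<in> borel_measurable borel" "g \<in> borel_measurable borel"
    unfolding f_def g_def by measurable
  have g_nonneg: "0 \<le> g t" for t
    by (simp add: g_def)
  have scale: "f (s * t) = s powr (p + q - 2) * g t" for t
  proof (cases "0 < t \<and> t < 1")
    case True
    then have "s * t < s" "0 < s * t"
      using assms by auto
    moreover have "s - s * t = s * (1 - t)"
      by (simp add: algebra_simps)
    ultimately show ?thesis
      using True assms by (simp add: f_def g_def powr_mult powr_add[symmetric])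
  next
    case False
    then have "\<not> (0 < s * t \<and> s * t < s)"
      using assms by (auto simp: zero_less_mult_iff)
    then show ?thesis
      using False by (auto simp: f_def g_def)
  qed
  have "((\<lambda>t. t powr (p - 1) * (1 - t) powr (q - 1)) has_integral Beta p q) {0<..<1}"
    using has_integral_Beta_real[OF assms(1,2)] by (simp add: has_integral_Icc_iff_Ioo)
  then have "((\<lambda>t. if t \<in> {0<..<1} then t powr (p - 1) * (1 - t) powr (q - 1) else 0) has_integral Beta p q) UNIV"
    by (simp only: has_integral_restrict_UNIV)
  moreover have "(\<lambda>t::real. if t \<in> {0<..<1} then t powr (p - 1) * (1 - t) powr (q - 1) else 0) = g"
    by (auto simp: g_def fun_eq_iff)
  ultimately have "(g has_integral Beta p q) UNIV"
    by simp
  then have "integral\<^sup>N lborel g = ennreal (Beta p q)"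
    by (intro nn_integral_has_integral_lborel) (auto simp: g_nonneg)
  then have "(\<integral>\<^sup>+t. ennreal (f (0 + s * t)) \<partial>lborel) = ennreal (s powr (p + q - 2)) * ennreal (Beta p q)"
    by (simp add: scale ennreal_mult' nn_integral_cmult)
  then have "(\<integral>\<^sup>+t. ennreal (f t) \<partial>lborel) = ennreal s * (ennreal (s powr (p + q - 2)) * ennreal (Beta p q))"
    using assms by (subst nn_integral_real_affine[where c = s and t = 0]) auto
  also have "\<dots> = ennreal (Beta p q * (s powr 1 * s powr (p + q - 2)))"
    using assms by (simp add: ennreal_mult'[symmetric] ennreal_mult''[symmetric] mult_ac)
  also have "s powr 1 * s powr (p + q - 2) = s powr (p + q - 1)"
    by (subst powr_add[symmetric]) simp
  finally show ?thesis
    by (simp add: f_def)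
qed

text \<open>
  The normalising constant of the Dirichlet density on a simplex of arbitrary size $s$. The size is kept
  variable because integrating out one coordinate at value $y$ leaves a simplex of size $s - y$; the
  remaining integral over $y$ is then a scaled Beta integral.
\<close>

lemma nn_integral_simplex:
  fixes a :: "'i \<Rightarrow> real" and b s :: real
  assumes "finite K" "\<And>i. i \<in> K \<Longrightarrow> 0 < a i" "0 < b" "0 < s"
  shows "(\<integral>\<^sup>+x. ennreal (if (\<forall>i\<in>K. 0 < x i) \<and> (\<Sum>i\<in>K. x i) < s
        then (\<Prod>i\<in>K. x i powr (a i - 1)) * (s - (\<Sum>i\<in>K. x i)) powr (b - 1) else 0) \<partial>(\<Pi>\<^sub>M i\<in>K. lborel))
    = ennreal ((\<Prod>i\<in>K. Gamma (a i)) * Gamma b / Gamma ((\<Sum>i\<in>K. a i) + b) * s powr ((\<Sum>i\<in>K. a i) + b - 1))"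
  using assms(1,2,4)
proof (induction K arbitrary: s rule: finite_induct)
  case empty
  then show ?case
    using assms(3) less_imp_neq[OF Gamma_real_pos[OF assms(3)]]
    by (simp add: PiM_empty nn_integral_count_space_finite)
next
  case (insert k K)
  interpret product_sigma_finite "\<lambda>_::'i. lborel :: real measure"
    by standard
  define F where "F = (\<lambda>K s x. if (\<forall>i\<in>K. 0 < x i) \<and> (\<Sum>i\<in>K. x i) < s
        then (\<Prod>i\<in>K. x i powr (a i - 1)) * (s - (\<Sum>i\<in>K. x i)) powr (b - 1) else (0::real))"
  define A where "A = (\<Sum>i\<in>K. a i) + b"
  define c where "c = (\<Prod>i\<in>K. Gamma (a i)) * Gamma b / Gamma A"
  have A: "0 < A"
    unfolding A_def using insert.prems assms(3) by (intro add_nonneg_pos sum_nonneg) (auto intro: less_imp_le)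
  have ak: "0 < a k"
    using insert.prems by simp
  have c: "0 \<le> c"
    unfolding c_def using insert.prems assms(3) A Gamma_real_pos
    by (intro divide_nonneg_pos mult_nonneg_nonneg prod_nonneg) (auto intro: less_imp_le)
  have meas [measurable]: "F L t \<in> borel_measurable (\<Pi>\<^sub>M i\<in>L. lborel)" if "finite L" for L t
    using that unfolding F_def by measurable
  \<comment> \<open>For y at least s the simplex of size s - y is empty, so the second factor vanishes there.\<close>
  have split: "F (insert k K) s (x(k := y))
    = (if 0 < y \<and> y < s then y powr (a k - 1) else 0) * F K (s - y) x" for x y
  proof -
    have *: "(\<Sum>i\<in>K. if i = k then y else x i) = (\<Sum>i\<in>K. x i)"
      "(\<Prod>i\<in>K. (if i = k then y else x i) powr (a i - 1)) = (\<Prod>i\<in>K. x i powr (a i - 1))"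
      "(\<forall>i\<in>K. 0 < (if i = k then y else x i)) \<longleftrightarrow> (\<forall>i\<in>K. 0 < x i)"
      using insert.hyps by (auto intro!: sum.cong prod.cong)
    have "0 \<le> (\<Sum>i\<in>K. x i)" if "\<forall>i\<in>K. 0 < x i"
      using that by (intro sum_nonneg) (auto intro: less_imp_le)
    then show ?thesis
      using insert.hyps by (auto simp: F_def * algebra_simps)
  qed
  have inner: "(\<integral>\<^sup>+x. ennreal (F K t x) \<partial>(\<Pi>\<^sub>M i\<in>K. lborel)) = ennreal (c * t powr (A - 1))" if "0 < t" for t
    using insert.IH[OF _ that] insert.prems unfolding F_def c_def A_def by simp
  have "(\<integral>\<^sup>+x. ennreal (F (insert k K) s x) \<partial>(\<Pi>\<^sub>M i\<in>insert k K. lborel))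
    = (\<integral>\<^sup>+y. (\<integral>\<^sup>+x. ennreal (F (insert k K) s (x(k := y))) \<partial>(\<Pi>\<^sub>M i\<in>K. lborel)) \<partial>lborel)"
    by (rule product_nn_integral_insert_rev) (use insert.hyps meas[of "insert k K"] in auto)
  also have "\<dots> = (\<integral>\<^sup>+y. ennreal c * ennreal (if 0 < y \<and> y < s then y powr (a k - 1) * (s - y) powr (A - 1) else 0) \<partial>lborel)"
  proof (rule nn_integral_cong)
    fix y :: real
    have m: "(\<lambda>x. ennreal (F K (s - y) x)) \<in> borel_measurable (\<Pi>\<^sub>M i\<in>K. lborel)"
      using meas[OF insert.hyps(1), of "s - y"] by measurable
    have "(\<integral>\<^sup>+x. ennreal (F (insert k K) s (x(k := y))) \<partial>(\<Pi>\<^sub>M i\<in>K. lborel))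
      = ennreal (if 0 < y \<and> y < s then y powr (a k - 1) else 0) * (\<integral>\<^sup>+x. ennreal (F K (s - y) x) \<partial>(\<Pi>\<^sub>M i\<in>K. lborel))"
      unfolding split by (simp add: ennreal_mult' nn_integral_cmult[OF m])
    also have "\<dots> = ennreal c * ennreal (if 0 < y \<and> y < s then y powr (a k - 1) * (s - y) powr (A - 1) else 0)"
      using c by (auto simp: inner ennreal_mult'[symmetric] mult_ac)
    finally show "(\<integral>\<^sup>+x. ennreal (F (insert k K) s (x(k := y))) \<partial>(\<Pi>\<^sub>M i\<in>K. lborel)) = \<dots>" .
  qed
  also have "\<dots> = ennreal c * ennreal (Beta (a k) A * s powr (a k + A - 1))"
    by (subst nn_integral_cmult) (use nn_integral_beta_scaled[OF ak A insert.prems(2)] in auto)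
  also have "\<dots> = ennreal ((\<Prod>i\<in>insert k K. Gamma (a i)) * Gamma b / Gamma ((\<Sum>i\<in>insert k K. a i) + b)
      * s powr ((\<Sum>i\<in>insert k K. a i) + b - 1))"
    using insert.hyps c A less_imp_neq[OF Gamma_real_pos[OF A]]
    by (simp add: ennreal_mult'[symmetric] Beta_def c_def A_def add_ac mult_ac)
  finally show ?case
    unfolding F_def .
qed

lemma dirichlet_density_nonneg:
  assumes "finite I" "\<And>i. i \<in> I \<Longrightarrow> 0 < a i" "i0 \<in> I"
  shows "0 \<le> dirichlet_density I i0 a x"
proof -
  have "0 < (\<Sum>i\<in>I. a i)"
    using assms by (intro sum_pos) auto
  then show ?thesis
    using assms Gamma_real_pos unfolding dirichlet_density_def
    by (auto intro!: mult_nonneg_nonneg divide_nonneg_pos prod_nonneg prod_pos less_imp_le[OF Gamma_real_pos])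
qed

lemma measurable_dirichlet_density [measurable]:
  assumes "finite I"
  shows "dirichlet_density I i0 a \<in> borel_measurable (\<Pi>\<^sub>M i\<in>I - {i0}. lborel)"
proof -
  have "finite (I - {i0})"
    using assms by simp
  then show ?thesis
    unfolding dirichlet_density_def[abs_def] by measurable
qed

lemma nn_integral_dirichlet_density:
  assumes "finite I" "\<And>i. i \<in> I \<Longrightarrow> 0 < a i" "i0 \<in> I"
  shows "(\<integral>\<^sup>+x. ennreal (dirichlet_density I i0 a x) \<partial>(\<Pi>\<^sub>M i\<in>I - {i0}. lborel)) = 1"
proof -
  let ?K = "I - {i0}"
  define A where "A = (\<Sum>i\<in>I. a i)"
  define c where "c = Gamma A / (\<Prod>i\<in>I. Gamma (a i))"
  have fin: "finite ?K" and pos: "\<And>i. i \<in> ?K \<Longrightarrow> 0 < a i" "0 < a i0"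
    using assms by auto
  have A: "0 < A"
    unfolding A_def using assms by (intro sum_pos) auto
  have A_split: "A = (\<Sum>i\<in>?K. a i) + a i0"
    using sum.remove[OF assms(1,3), of a] by (simp add: A_def)
  have P: "(\<Prod>i\<in>I. Gamma (a i)) = (\<Prod>i\<in>?K. Gamma (a i)) * Gamma (a i0)"
    using prod.remove[OF assms(1,3), of "\<lambda>i. Gamma (a i)"] by (simp add: mult.commute)
  have P_pos: "0 < (\<Prod>i\<in>I. Gamma (a i))"
    using assms by (intro prod_pos ballI Gamma_real_pos) auto
  have c: "0 < c"
    using P_pos A by (simp add: c_def Gamma_real_pos)
  let ?f = "\<lambda>x. if (\<forall>i\<in>?K. 0 < x i) \<and> (\<Sum>i\<in>?K. x i) < 1
        then (\<Prod>i\<in>?K. x i powr (a i - 1)) * (1 - (\<Sum>i\<in>?K. x i)) powr (a i0 - 1) else 0"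
  have dens: "dirichlet_density I i0 a x = c * ?f x" for x
    by (simp add: dirichlet_density_def c_def A_def)
  have m: "(\<lambda>x. ennreal (?f x)) \<in> borel_measurable (\<Pi>\<^sub>M i\<in>?K. lborel)"
    using fin by measurable
  have "(\<integral>\<^sup>+x. ennreal (dirichlet_density I i0 a x) \<partial>(\<Pi>\<^sub>M i\<in>?K. lborel))
     = ennreal c * (\<integral>\<^sup>+x. ennreal (?f x) \<partial>(\<Pi>\<^sub>M i\<in>?K. lborel))"
    unfolding dens using c by (subst nn_integral_cmult[OF m, symmetric]) (simp add: ennreal_mult')
  also have "(\<integral>\<^sup>+x. ennreal (?f x) \<partial>(\<Pi>\<^sub>M i\<in>?K. lborel)) = ennreal ((\<Prod>i\<in>I. Gamma (a i)) / Gamma A)"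
    using nn_integral_simplex[OF fin pos zero_less_one] by (simp add: P A_split)
  also have "ennreal c * \<dots> = 1"
    using P_pos Gamma_real_pos[OF A] c by (simp add: ennreal_mult'[symmetric] c_def)
  finally show ?thesis .
qed

text \<open>
  Multiplying a Dirichlet density by the $i$-th coordinate of the simplex raises the $i$-th parameter by one,
  up to a constant. This covers the dependent coordinate \<open>i0\<close> as well and reduces all moments to the
  normalisation of the density.
\<close>

lemma dirichlet_density_times_coordinate:
  assumes "finite I" "\<And>i. i \<in> I \<Longrightarrow> 0 < a i" "i0 \<in> I" "i \<in> I"
  shows "dirichlet_density I i0 a x * (x(i0 := 1 - (\<Sum>i\<in>I - {i0}. x i))) i
    = a i / (\<Sum>i\<in>I. a i) * dirichlet_density I i0 (a(i := a i + 1)) x"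
proof (cases "(\<forall>i\<in>I - {i0}. 0 < x i) \<and> (\<Sum>i\<in>I - {i0}. x i) < 1")
  case True
  let ?K = "I - {i0}"
  define A where "A = (\<Sum>i\<in>I. a i)"
  define P where "P = (\<Prod>j\<in>I. Gamma (a j))"
  define s where "s = 1 - (\<Sum>i\<in>?K. x i)"
  define Q where "Q = (\<Prod>j\<in>?K. x j powr (a j - 1)) * s powr (a i0 - 1)"
  have s: "0 < s"
    using True by (simp add: s_def)
  have A: "0 < A"
    unfolding A_def using assms by (intro sum_pos) auto
  have P: "0 < P"
    unfolding P_def using assms by (intro prod_pos ballI Gamma_real_pos) auto
  have ai: "0 < a i"
    using assms by auto
  let ?a' = "a(i := a i + 1)"
  have A': "(\<Sum>j\<in>I. ?a' j) = A + 1"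
  proof -
    have "(\<Sum>j\<in>I - {i}. ?a' j) = (\<Sum>j\<in>I - {i}. a j)"
      by (intro sum.cong) auto
    then show ?thesis
      using sum.remove[OF assms(1,4), of a] sum.remove[OF assms(1,4), of ?a']
      unfolding A_def by simp
  qed
  have P': "(\<Prod>j\<in>I. Gamma (?a' j)) = a i * P"
  proof -
    have "(\<Prod>j\<in>I - {i}. Gamma (?a' j)) = (\<Prod>j\<in>I - {i}. Gamma (a j))"
      by (intro prod.cong) auto
    moreover have "Gamma (a i + 1) = a i * Gamma (a i)"
      using ai by (intro Gamma_plus1) (auto simp: nonpos_Ints_def)
    ultimately show ?thesis
      using prod.remove[OF assms(1,4), of "\<lambda>j. Gamma (a j)"] prod.remove[OF assms(1,4), of "\<lambda>j. Gamma (?a' j)"]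
      unfolding P_def by simp
  qed
  have Q': "(\<Prod>j\<in>?K. x j powr (?a' j - 1)) * s powr (?a' i0 - 1) = Q * (x(i0 := s)) i"
  proof (cases "i = i0")
    case True
    have "s powr a i0 = s powr (a i0 - 1) * s"
      using s by (simp add: powr_diff)
    moreover have "(\<Prod>j\<in>?K. x j powr (?a' j - 1)) = (\<Prod>j\<in>?K. x j powr (a j - 1))"
      using True by (intro prod.cong) auto
    ultimately show ?thesis
      using True by (simp add: Q_def mult_ac)
  next
    case False
    then have iK: "i \<in> ?K" "finite ?K"
      using assms by auto
    then have xi: "0 < x i"
      using True by auto
    have "x i powr a i = x i powr (a i - 1) * x i"
      using xi by (simp add: powr_diff)
    moreover have "(\<Prod>j\<in>?K - {i}. x j powr (?a' j - 1)) = (\<Prod>j\<in>?K - {i}. x j powr (a j - 1))"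
      by (intro prod.cong) auto
    ultimately show ?thesis
      using False 
      using prod.remove[OF iK(2,1), of "\<lambda>j. x j powr (a j - 1)"]
        prod.remove[OF iK(2,1), of "\<lambda>j. x j powr (?a' j - 1)"]
      by (simp add: Q_def mult_ac)
  qed
  have dens: "dirichlet_density I i0 a x = Gamma A / P * Q"
    using True by (simp add: dirichlet_density_def A_def P_def Q_def s_def)
  have dens': "dirichlet_density I i0 ?a' x = Gamma (A + 1) / (a i * P) * (Q * (x(i0 := s)) i)"
    using True unfolding Q'[symmetric] P'[symmetric] A'[symmetric]
    by (simp add: dirichlet_density_def s_def del: fun_upd_apply)
  have Gamma': "Gamma (A + 1) = A * Gamma A"
    using A by (intro Gamma_plus1) (auto simp: nonpos_Ints_def)
  show ?thesis
    unfolding A_def[symmetric] s_def[symmetric] dens dens' Gamma'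
    using A ai P by (simp add: divide_simps del: fun_upd_apply)
next
  case False
  then show ?thesis
    by (auto simp: dirichlet_density_def)
qed

lemma sets_dirichlet [measurable_cong]: "sets (dirichlet I i0 a) = sets (\<Pi>\<^sub>M i\<in>I. borel)"
  by (simp add: dirichlet_def)

lemma measurable_simplex_completion:
  fixes i0 :: 'i
  assumes "finite I" "i0 \<in> I"
  shows "(\<lambda>x. x(i0 := 1 - (\<Sum>i\<in>I - {i0}. x i)))
    \<in> (\<Pi>\<^sub>M i\<in>I - {i0}. lborel) \<rightarrow>\<^sub>M (\<Pi>\<^sub>M i\<in>I. borel :: real measure)"
proof (rule measurable_fun_upd)
  show "I = I - {i0} \<union> {i0}"
    using assms by auto
  show "(\<lambda>x. x) \<in> (\<Pi>\<^sub>M i\<in>I - {i0}. lborel) \<rightarrow>\<^sub>M (\<Pi>\<^sub>M i\<in>I - {i0}. borel :: real measure)"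
  proof (rule measurable_ident_sets)
    show "sets (\<Pi>\<^sub>M i\<in>I - {i0}. (lborel :: real measure)) = sets (\<Pi>\<^sub>M i\<in>I - {i0}. borel)"
      by (intro sets_PiM_cong refl sets_lborel)
  qed
  show "(\<lambda>x. 1 - (\<Sum>i\<in>I - {i0}. x i)) \<in> (\<Pi>\<^sub>M i\<in>I - {i0}. lborel) \<rightarrow>\<^sub>M (borel :: real measure)"
  proof (intro borel_measurable_diff borel_measurable_const borel_measurable_sum)
    fix i assume "i \<in> I - {i0}"
    then have "(\<lambda>x. x i) \<in> (\<Pi>\<^sub>M i\<in>I - {i0}. lborel) \<rightarrow>\<^sub>M (lborel :: real measure)"
      by (rule measurable_component_singleton)
    then show "(\<lambda>x. x i) \<in> (\<Pi>\<^sub>M i\<in>I - {i0}. lborel) \<rightarrow>\<^sub>M (borel :: real measure)"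
      by simp
  qed
qed

lemma has_bochner_integral_dirichlet:
  fixes f :: "('i \<Rightarrow> real) \<Rightarrow> real"
  assumes I: "finite I" "\<And>i. i \<in> I \<Longrightarrow> 0 < a i" "i0 \<in> I"
    and f: "f \<in> borel_measurable (\<Pi>\<^sub>M i\<in>I. borel)"
    and h: "has_bochner_integral (\<Pi>\<^sub>M i\<in>I - {i0}. lborel)
      (\<lambda>x. dirichlet_density I i0 a x * f (x(i0 := 1 - (\<Sum>i\<in>I - {i0}. x i)))) v"
  shows "has_bochner_integral (dirichlet I i0 a) f v"
proof -
  note compl = measurable_simplex_completion[OF I(1,3)]
  have "has_bochner_integral
      (density (\<Pi>\<^sub>M i\<in>I - {i0}. lborel) (\<lambda>x. ennreal (dirichlet_density I i0 a x)))
      (\<lambda>x. f (x(i0 := 1 - (\<Sum>i\<in>I - {i0}. x i)))) v"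
  proof (rule has_bochner_integral_density)
    show "(\<lambda>x. f (x(i0 := 1 - (\<Sum>i\<in>I - {i0}. x i)))) \<in> borel_measurable (\<Pi>\<^sub>M i\<in>I - {i0}. lborel)"
      by (rule measurable_compose[OF compl f])
    show "dirichlet_density I i0 a \<in> borel_measurable (\<Pi>\<^sub>M i\<in>I - {i0}. lborel)"
      by (rule measurable_dirichlet_density[OF I(1)])
    show "AE x in \<Pi>\<^sub>M i\<in>I - {i0}. lborel. 0 \<le> dirichlet_density I i0 a x"
      by (intro AE_I2 dirichlet_density_nonneg[OF I])
  qed (use h in simp)
  then show ?thesis
    unfolding dirichlet_def
    by (intro has_bochner_integral_distr f) (simp_all add: compl)
qed

lemma has_bochner_integral_dirichlet_density:
  assumes I: "finite I" "\<And>i. i \<in> I \<Longrightarrow> 0 < a i" "i0 \<in> I"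
  shows "has_bochner_integral (\<Pi>\<^sub>M i\<in>I - {i0}. lborel) (dirichlet_density I i0 a) 1"
  using nn_integral_dirichlet_density[OF I] dirichlet_density_nonneg[OF I]
  by (intro has_bochner_integral_nn_integral measurable_dirichlet_density I(1)) auto

lemma prob_space_dirichlet:
  assumes I: "finite I" "\<And>i. i \<in> I \<Longrightarrow> 0 < a i" "i0 \<in> I"
  shows "prob_space (dirichlet I i0 a)"
proof
  have "has_bochner_integral (dirichlet I i0 a) (\<lambda>_. 1::real) 1"
    by (rule has_bochner_integral_dirichlet[OF I])
      (use has_bochner_integral_dirichlet_density[OF I] in auto)
  then have "measure (dirichlet I i0 a) (space (dirichlet I i0 a)) = 1"
    by (simp add: has_bochner_integral_iff)
  then show "emeasure (dirichlet I i0 a) (space (dirichlet I i0 a)) = 1"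
    by (metis Sigma_Algebra.measure_def enn2real_eq_posreal_iff ennreal_1 zero_less_one)
qed

lemma dirichlet_moments:
  assumes I: "finite I" "\<And>i. i \<in> I \<Longrightarrow> 0 < a i" "i0 \<in> I" "i \<in> I"
  defines "A \<equiv> \<Sum>i\<in>I. a i"
  shows "has_bochner_integral (dirichlet I i0 a) (\<lambda>\<theta>. \<theta> i) (a i / A)"
    and "has_bochner_integral (dirichlet I i0 a) (\<lambda>\<theta>. (\<theta> i)\<^sup>2) (a i / A * ((a i + 1) / (A + 1)))"
proof -
  let ?a' = "a(i := a i + 1)" and ?a'' = "(a(i := a i + 1))(i := a i + 1 + 1)"
  let ?\<Theta> = "\<lambda>x. x(i0 := 1 - (\<Sum>i\<in>I - {i0}. x i))"
  have pos': "0 < ?a' j" "0 < ?a'' j" if "j \<in> I" for j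
    using I(2)[OF that] I(2)[OF I(4)] by auto
  have m [measurable]: "(\<lambda>\<theta>. \<theta> i :: real) \<in> borel_measurable (\<Pi>\<^sub>M i\<in>I. borel)"
    using I by measurable
  have A': "(\<Sum>j\<in>I. ?a' j) = A + 1"
  proof -
    have "(\<Sum>j\<in>I - {i}. ?a' j) = (\<Sum>j\<in>I - {i}. a j)"
      by (intro sum.cong) auto
    then show ?thesis
      using sum.remove[OF I(1,4), of a] sum.remove[OF I(1,4), of ?a']
      unfolding A_def by simp
  qed
  have step1: "dirichlet_density I i0 a x * ?\<Theta> x i = a i / A * dirichlet_density I i0 ?a' x" for x
    using dirichlet_density_times_coordinate[where a = a, OF I] unfolding A_def .
  have step2: "dirichlet_density I i0 ?a' x * ?\<Theta> x i = (a i + 1) / (A + 1) * dirichlet_density I i0 ?a'' x" for x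
    using dirichlet_density_times_coordinate[where a = ?a', OF I(1) pos'(1) I(3,4), of x]
    unfolding A' by simp
  show "has_bochner_integral (dirichlet I i0 a) (\<lambda>\<theta>. \<theta> i) (a i / A)"
  proof (rule has_bochner_integral_dirichlet[OF I(1-3) m])
    show "has_bochner_integral (\<Pi>\<^sub>M i\<in>I - {i0}. lborel) (\<lambda>x. dirichlet_density I i0 a x * ?\<Theta> x i) (a i / A)"
      unfolding step1
      using has_bochner_integral_mult_right[OF has_bochner_integral_dirichlet_density[where a = ?a', OF I(1) pos'(1) I(3)], of "a i / A"]
      by simp
  qed
  have *: "dirichlet_density I i0 a x * (?\<Theta> x i)\<^sup>2
    = a i / A * ((a i + 1) / (A + 1)) * dirichlet_density I i0 ?a'' x" for x
    unfolding power2_eq_square mult.assoc[symmetric] step1 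
    by (simp only: mult.assoc step2)
  show "has_bochner_integral (dirichlet I i0 a) (\<lambda>\<theta>. (\<theta> i)\<^sup>2) (a i / A * ((a i + 1) / (A + 1)))"
  proof (rule has_bochner_integral_dirichlet[OF I(1-3)])
    show "(\<lambda>\<theta>. (\<theta> i :: real)\<^sup>2) \<in> borel_measurable (\<Pi>\<^sub>M i\<in>I. borel)"
      by (intro borel_measurable_power m)
    show "has_bochner_integral (\<Pi>\<^sub>M i\<in>I - {i0}. lborel) (\<lambda>x. dirichlet_density I i0 a x * (?\<Theta> x i)\<^sup>2)
      (a i / A * ((a i + 1) / (A + 1)))"
      unfolding *
      using has_bochner_integral_mult_right[OF has_bochner_integral_dirichlet_density[where a = ?a'', OF I(1) pos'(2) I(3)],
        of "a i / A * ((a i + 1) / (A + 1))"]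
      by simp
  qed
qed

lemma (in prob_space) expectation_abs_le_sqrt:
  fixes Y :: "'a \<Rightarrow> real"
  assumes [measurable]: "Y \<in> borel_measurable M" and sq: "integrable M (\<lambda>x. (Y x)\<^sup>2)"
    and le: "expectation (\<lambda>x. (Y x)\<^sup>2) \<le> v"
  shows "integrable M Y" "expectation (\<lambda>x. \<bar>Y x\<bar>) \<le> sqrt v"
proof -
  show int: "integrable M Y"
    by (rule square_integrable_imp_integrable) (use sq in auto)
  have "0 \<le> variance (\<lambda>x. \<bar>Y x\<bar>)"
    by (rule variance_positive)
  also have "\<dots> = expectation (\<lambda>x. (Y x)\<^sup>2) - (expectation (\<lambda>x. \<bar>Y x\<bar>))\<^sup>2"
    using int sq by (subst variance_eq) auto
  finally show "expectation (\<lambda>x. \<bar>Y x\<bar>) \<le> sqrt v"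
    using le by (intro real_le_rsqrt) auto
qed

lemma sum_sqrt_le:
  fixes u :: "'i \<Rightarrow> real"
  assumes "finite I" "\<And>i. i \<in> I \<Longrightarrow> 0 \<le> u i"
  shows "(\<Sum>i\<in>I. sqrt (u i)) \<le> sqrt (real (card I) * (\<Sum>i\<in>I. u i))"
proof (rule real_le_rsqrt)
  have "(\<Sum>i\<in>I. sqrt (u i))\<^sup>2 \<le> real (card I) * (\<Sum>i\<in>I. (sqrt (u i))\<^sup>2)"
    using sum_squared_le_sum_of_squares[of "\<lambda>i. sqrt (u i)" I] by (simp add: mult.commute)
  also have "(\<Sum>i\<in>I. (sqrt (u i))\<^sup>2) = (\<Sum>i\<in>I. u i)"
    using assms by (intro sum.cong) auto
  finally show "(\<Sum>i\<in>I. sqrt (u i))\<^sup>2 \<le> real (card I) * (\<Sum>i\<in>I. u i)" .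
qed

text \<open>
  The mean absolute deviation of a coordinate from its mean $m_i = a_i / A$ is at most its standard deviation,
  hence at most $\sqrt{m_i / A}$. The means sum to one, so Cauchy-Schwarz bounds the sum of these
  deviations by the square root of the number of coordinates over $A$; Markov's inequality finishes.
\<close>

lemma dirichlet_tail:
  fixes q :: "'i \<Rightarrow> real"
  assumes I: "finite I" "\<And>i. i \<in> I \<Longrightarrow> 0 < a i" "i0 \<in> I" and t: "0 < t"
  defines "A \<equiv> \<Sum>i\<in>I. a i"
  shows "measure (dirichlet I i0 a) {\<theta>\<in>space (dirichlet I i0 a). t \<le> (\<Sum>i\<in>I. \<bar>\<theta> i - q i\<bar>)}
    \<le> (sqrt (real (card I) / A) + (\<Sum>i\<in>I. \<bar>a i / A - q i\<bar>)) / t"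
proof -
  let ?D = "dirichlet I i0 a"
  interpret prob_space ?D
    by (rule prob_space_dirichlet[OF I])
  have A: "0 < A"
    unfolding A_def using I by (intro sum_pos) auto
  have m [measurable]: "(\<lambda>\<theta>. \<theta> i) \<in> borel_measurable ?D" if "i \<in> I" for i
    using that by measurable
  have dev: "integrable ?D (\<lambda>\<theta>. \<theta> i - a i / A)"
    "expectation (\<lambda>\<theta>. \<bar>\<theta> i - a i / A\<bar>) \<le> sqrt (a i / A / A)" if i: "i \<in> I" for i
  proof -
    note mom = dirichlet_moments[where a = a, OF I i, folded A_def]
    have int: "integrable ?D (\<lambda>\<theta>. \<theta> i)" "integrable ?D (\<lambda>\<theta>. (\<theta> i)\<^sup>2)"
      and ex: "expectation (\<lambda>\<theta>. \<theta> i) = a i / A"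
        "expectation (\<lambda>\<theta>. (\<theta> i)\<^sup>2) = a i / A * ((a i + 1) / (A + 1))"
      using mom by (auto simp: has_bochner_integral_iff)
    have le: "a i \<le> A"
      unfolding A_def using I i by (intro member_le_sum) (auto intro: less_imp_le)
    have ai: "0 < a i"
      using I i by auto
    have "variance (\<lambda>\<theta>. \<theta> i) = a i / A * ((a i + 1) / (A + 1)) - (a i / A)\<^sup>2"
      using int ex by (subst variance_eq) auto
    also have "\<dots> = a i / A * ((a i + 1) / (A + 1) - a i / A)"
      by (simp add: power2_eq_square algebra_simps)
    also have "\<dots> = a i / A * ((A - a i) / (A * (A + 1)))"
    proof -
      have "(a i + 1) / (A + 1) - a i / A = (A - a i) / (A * (A + 1))"
        using A by (simp add: field_simps)
      then show ?thesis
        by simp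
    qed
    also have "\<dots> \<le> a i / A * (1 / A)"
    proof (rule mult_left_mono)
      have "(A - a i) / (A * (A + 1)) \<le> (A + 1) / (A * (A + 1))"
        using A ai by (intro divide_right_mono) auto
      then show "(A - a i) / (A * (A + 1)) \<le> 1 / A"
        using A by simp
    qed (use A ai in auto)
    finally have var: "expectation (\<lambda>\<theta>. (\<theta> i - a i / A)\<^sup>2) \<le> a i / A / A"
      by (simp add: ex)
    have sq: "integrable ?D (\<lambda>\<theta>. (\<theta> i - a i / A)\<^sup>2)"
      using int by (simp add: power2_diff)
    show "integrable ?D (\<lambda>\<theta>. \<theta> i - a i / A)"
      "expectation (\<lambda>\<theta>. \<bar>\<theta> i - a i / A\<bar>) \<le> sqrt (a i / A / A)"
      using expectation_abs_le_sqrt[OF _ sq var] i by auto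
  qed
  have int: "integrable ?D (\<lambda>\<theta>. \<bar>\<theta> i - q i\<bar>)" if "i \<in> I" for i
  proof -
    have "integrable ?D (\<lambda>\<theta>. (\<theta> i - a i / A) + (a i / A - q i))"
      using dev(1)[OF that] by (intro Bochner_Integration.integrable_add) auto
    then show ?thesis
      by simp
  qed
  have "expectation (\<lambda>\<theta>. \<Sum>i\<in>I. \<bar>\<theta> i - q i\<bar>) = (\<Sum>i\<in>I. expectation (\<lambda>\<theta>. \<bar>\<theta> i - q i\<bar>))"
    using int by (rule Bochner_Integration.integral_sum)
  also have "\<dots> \<le> (\<Sum>i\<in>I. sqrt (a i / A / A) + \<bar>a i / A - q i\<bar>)"
  proof (rule sum_mono)
    fix i assume i: "i \<in> I"
    have "expectation (\<lambda>\<theta>. \<bar>\<theta> i - q i\<bar>) \<le> expectation (\<lambda>\<theta>. \<bar>\<theta> i - a i / A\<bar> + \<bar>a i / A - q i\<bar>)"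
      using int[OF i] dev(1)[OF i] by (intro integral_mono) (auto intro: Bochner_Integration.integrable_add)
    also have "\<dots> = expectation (\<lambda>\<theta>. \<bar>\<theta> i - a i / A\<bar>) + \<bar>a i / A - q i\<bar>"
      using dev(1)[OF i] by (subst Bochner_Integration.integral_add) (auto simp: prob_space)
    finally show "expectation (\<lambda>\<theta>. \<bar>\<theta> i - q i\<bar>) \<le> sqrt (a i / A / A) + \<bar>a i / A - q i\<bar>"
      using dev(2)[OF i] by linarith
  qed
  also have "\<dots> = (\<Sum>i\<in>I. sqrt (a i / A / A)) + (\<Sum>i\<in>I. \<bar>a i / A - q i\<bar>)"
    by (rule sum.distrib)
  also have "(\<Sum>i\<in>I. sqrt (a i / A / A)) \<le> sqrt (real (card I) * (\<Sum>i\<in>I. a i / A / A))"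
    using I A by (intro sum_sqrt_le) (auto intro: less_imp_le)
  also have "(\<Sum>i\<in>I. a i / A / A) = 1 / A"
    using A by (simp add: sum_divide_distrib[symmetric] A_def[symmetric])
  finally have E: "expectation (\<lambda>\<theta>. \<Sum>i\<in>I. \<bar>\<theta> i - q i\<bar>) \<le> sqrt (real (card I) / A) + (\<Sum>i\<in>I. \<bar>a i / A - q i\<bar>)"
    by simp
  have "measure ?D {\<theta>\<in>space ?D. t \<le> (\<Sum>i\<in>I. \<bar>\<theta> i - q i\<bar>)} \<le> expectation (\<lambda>\<theta>. \<Sum>i\<in>I. \<bar>\<theta> i - q i\<bar>) / t"
    using t int by (intro integral_Markov_inequality_measure[where A = "space ?D"]) (auto intro: sum_nonneg)
  also have "\<dots> \<le> (sqrt (real (card I) / A) + (\<Sum>i\<in>I. \<bar>a i / A - q i\<bar>)) / t"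
    using E t by (intro divide_right_mono) auto
  finally show ?thesis .
qed

section \<open>Histograms and cellwise averages\<close>

lemma unit_cube_eq_cbox: "unit_cube = cbox 0 (1 :: real ^ 'd)"
  by (auto simp: unit_cube_def mem_box_cart)

lemma unit_cube_lmeasurable: "(unit_cube :: (real ^ 'd) set) \<in> lmeasurable"
  by (simp add: unit_cube_eq_cbox)

lemma sets_unit_cube [measurable]: "(unit_cube :: (real ^ 'd) set) \<in> sets lebesgue"
  by (simp add: unit_cube_eq_cbox)

lemma finite_measure_cube: "finite_measure (lebesgue_on (unit_cube :: (real ^ 'd) set))"
  by (rule finite_measure_lebesgue_on[OF unit_cube_lmeasurable])

lemma measure_unit_cube: "measure (lebesgue_on unit_cube) (unit_cube :: (real ^ 'd) set) = 1"
proof -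
  have "(0 :: real ^ 'd) \<in> cbox 0 1"
    by (simp add: mem_box_cart)
  then have "cbox 0 (1 :: real ^ 'd) \<noteq> {}"
    by blast
  then have "measure lebesgue (cbox 0 (1 :: real ^ 'd)) = 1"
    by (simp add: content_cbox_cart)
  then show ?thesis
    by (subst measure_restrict_space) (auto simp: unit_cube_eq_cbox)
qed

lemma card_vec_set:
  fixes S :: "'a set"
  assumes "finite S"
  shows "finite {v :: 'a ^ 'd. \<forall>k. v $ k \<in> S}" "card {v :: 'a ^ 'd. \<forall>k. v $ k \<in> S} = card S ^ CARD('d)"
proof -
  have "bij_betw vec_lambda (PiE (UNIV :: 'd set) (\<lambda>_. S)) {v :: 'a ^ 'd. \<forall>k. v $ k \<in> S}"
    by (rule bij_betw_byWitness[where f' = vec_nth]) (auto simp: PiE_UNIV_domain)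
  moreover have "finite (PiE (UNIV :: 'd set) (\<lambda>_. S))"
    using assms by (intro finite_PiE) auto
  moreover have "card (PiE (UNIV :: 'd set) (\<lambda>_. S)) = card S ^ CARD('d)"
    by (simp add: card_PiE)
  ultimately show "finite {v :: 'a ^ 'd. \<forall>k. v $ k \<in> S}" "card {v :: 'a ^ 'd. \<forall>k. v $ k \<in> S} = card S ^ CARD('d)"
    by (auto dest: bij_betw_finite bij_betw_same_card)
qed

lemma grid_eq: "grid J = {j. \<forall>k. j $ k \<in> {1..J}}"
  by (auto simp: grid_def)

lemma finite_grid [simp]: "finite (grid J :: (nat ^ 'd) set)"
  unfolding grid_eq by (rule card_vec_set) simp

lemma card_grid: "card (grid J :: (nat ^ 'd) set) = J ^ CARD('d)"
  unfolding grid_eq by (subst card_vec_set) auto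

lemma one_in_grid: "0 < J \<Longrightarrow> 1 \<in> grid J"
  by (simp add: grid_def)

lemma cell_bounds:
  assumes "x \<in> cell J j"
  shows "(real (j $ k) - 1) / real J \<le> x $ k" "x $ k \<le> real (j $ k) / real J"
  using assms by (auto simp: cell_def less_imp_le split: if_splits)

lemma in_cell:
  assumes "\<And>k. (real (j $ k) - 1) / real J < x $ k" "\<And>k. x $ k \<le> real (j $ k) / real J"
  shows "x \<in> cell J j"
proof (cases "j = 1")
  case True
  then show ?thesis
    using assms by (auto simp: cell_def intro: less_imp_le)
next
  case False
  then show ?thesis
    using assms by (simp add: cell_def)
qed

lemma cell_subset_cube:
  assumes "0 < J" "j \<in> grid J"
  shows "cell J j \<subseteq> unit_cube"
proof
  fix x assume x: "x \<in> cell J j"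
  have "0 \<le> x $ k \<and> x $ k \<le> 1" for k
  proof -
    have "1 \<le> j $ k" "j $ k \<le> J"
      using assms by (auto simp: grid_def)
    then have "0 \<le> (real (j $ k) - 1) / real J" "real (j $ k) / real J \<le> 1"
      using assms by auto
    then show ?thesis
      using cell_bounds[OF x, of k] by linarith
  qed
  then show "x \<in> unit_cube"
    by (simp add: unit_cube_def)
qed

text \<open>
  The lower faces of every cell other than the first one are open, which excludes that a shared point sits on
  the boundary between the two cells.
\<close>

lemma cell_index_le:
  assumes "0 < J" "i \<in> grid J" "j \<in> grid J" "x \<in> cell J i" "x \<in> cell J j" "j \<noteq> 1"
  shows "j $ k \<le> i $ k"
proof -
  have "(real (j $ k) - 1) / real J < x $ k"
    using assms by (simp add: cell_def)
  also have "\<dots> \<le> real (i $ k) / real J"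
    using cell_bounds(2)[OF assms(4)] .
  finally have "real (j $ k) - 1 < real (i $ k)"
    using assms(1) by (simp add: divide_less_cancel)
  then show ?thesis
    by linarith
qed

lemma cell_unique:
  assumes "0 < J" "i \<in> grid J" "j \<in> grid J" "x \<in> cell J i" "x \<in> cell J j"
  shows "i = j"
proof -
  have ge: "1 \<le> i $ k" "1 \<le> j $ k" for k
    using assms by (auto simp: grid_def)
  consider "i = 1" "j = 1" | "i = 1" "j \<noteq> 1" | "i \<noteq> 1" "j = 1" | "i \<noteq> 1" "j \<noteq> 1"
    by blast
  then show ?thesis
  proof cases
    case 2
    then show ?thesis
      using cell_index_le[OF assms(1,2,3,4,5) 2(2)] ge
      by (simp add: vec_eq_iff le_antisym)
  next
    case 3
    then show ?thesis
      using cell_index_le[OF assms(1,3,2,5,4) 3(1)] ge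
      by (simp add: vec_eq_iff le_antisym)
  next
    case 4
    then show ?thesis
      using cell_index_le[OF assms(1,2,3,4,5) 4(2)] cell_index_le[OF assms(1,3,2,5,4) 4(1)]
      by (simp add: vec_eq_iff le_antisym)
  qed simp
qed

text \<open>
  Points with a vanishing coordinate have to be excluded: a cell that touches a face of the cube without being the
  first cell is open there.
\<close>

lemma cells_cover:
  assumes "0 < J" "x \<in> unit_cube" "\<And>k. x $ k \<noteq> 0"
  shows "\<exists>j\<in>grid J. x \<in> cell J j"
proof -
  define j where "j = (\<chi> k. nat \<lceil>real J * x $ k\<rceil>)"
  have x: "0 < x $ k" "x $ k \<le> 1" for k
    using assms(2) assms(3)[of k] by (simp_all add: unit_cube_def order_less_le)
  then have Jx: "0 < real J * x $ k" "real J * x $ k \<le> real J" for k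
    using assms(1) by (auto simp: mult_left_le)
  have jk: "real (j $ k) = of_int \<lceil>real J * x $ k\<rceil>" for k
    using Jx[of k] by (simp add: j_def)
  have up: "real J * x $ k \<le> real (j $ k)" and lo: "real (j $ k) - 1 < real J * x $ k" for k
    unfolding jk by linarith+
  have "1 \<le> j $ k \<and> j $ k \<le> J" for k
  proof
    show "1 \<le> j $ k"
      using up[of k] Jx(1)[of k] by linarith
    show "j $ k \<le> J"
      using lo[of k] Jx(2)[of k] by linarith
  qed
  then have "j \<in> grid J"
    by (simp add: grid_def)
  moreover have "x \<in> cell J j"
    using up lo assms(1) by (intro in_cell) (auto simp: field_simps)
  ultimately show ?thesis
    by blast
qed

lemma negligible_coordinate_hyperplanes: "negligible {x :: real ^ 'd. \<exists>k. x $ k = 0}"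
proof -
  have "{x :: real ^ 'd. \<exists>k. x $ k = 0} = (\<Union>k. {x. x $ k = 0})"
    by auto
  also have "negligible \<dots>"
  proof (intro negligible_Union finite_imageI finite ballI)
    fix S assume "S \<in> range (\<lambda>k. {x :: real ^ 'd. x $ k = 0})"
    then obtain k where "S = {x :: real ^ 'd. x \<bullet> axis k 1 = 0}"
      by (auto simp: cart_eq_inner_axis)
    then show "negligible S"
      using negligible_standard_hyperplane[of "axis k 1 :: real ^ 'd" 0] by (simp add: axis_in_Basis_iff)
  qed
  finally show ?thesis .
qed

lemma AE_cube_cells:
  assumes "0 < J"
  shows "AE x in lebesgue_on (unit_cube :: (real ^ 'd) set). \<exists>j\<in>grid J. x \<in> cell J j"
proof -
  have "{x :: real ^ 'd. \<exists>k. x $ k = 0} \<in> null_sets lebesgue"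
    using negligible_coordinate_hyperplanes by (simp add: negligible_iff_null_sets)
  then have "AE x in lebesgue. x \<notin> {x :: real ^ 'd. \<exists>k. x $ k = 0}"
    by (rule AE_not_in)
  then have "AE x in lebesgue. x \<in> unit_cube \<longrightarrow> (\<exists>j\<in>grid J. x \<in> cell J (j :: nat ^ 'd))"
    by eventually_elim (use assms cells_cover in blast)
  then show ?thesis
    by (subst AE_restrict_space_iff) auto
qed

lemma sets_cell [measurable]: "cell J j \<in> sets (borel :: (real ^ 'd) measure)"
proof -
  have "{x :: real ^ 'd. \<forall>k. 0 \<le> x $ k \<and> x $ k \<le> 1 / real J} \<in> sets borel"
    by (intro borel_closed closed_Collect_all closed_Collect_conj closed_Collect_le continuous_intros)
  moreover have "{x :: real ^ 'd. \<forall>k. (real (j $ k) - 1) / real J < x $ k \<and> x $ k \<le> real (j $ k) / real J} \<in> sets borel"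
  proof -
    have "{x :: real ^ 'd. \<forall>k. (real (j $ k) - 1) / real J < x $ k \<and> x $ k \<le> real (j $ k) / real J}
      = (\<Inter>k\<in>UNIV. {x. (real (j $ k) - 1) / real J < x $ k} \<inter> {x. x $ k \<le> real (j $ k) / real J})"
      by auto
    also have "\<dots> \<in> sets borel"
      by (intro sets.finite_INT sets.Int borel_open borel_closed open_Collect_less closed_Collect_le continuous_intros) auto
    finally show ?thesis .
  qed
  ultimately show ?thesis
    by (simp add: cell_def)
qed

lemma measure_cell:
  assumes "0 < J" "j \<in> (grid J :: (nat ^ 'd) set)"
  shows "measure (lebesgue_on unit_cube) (cell J j) = 1 / real J ^ CARD('d)"
proof -
  define l u :: "real ^ 'd" where "l = (\<chi> k. (real (j $ k) - 1) / real J)" and "u = (\<chi> k. real (j $ k) / real J)"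
  have lu: "l $ k < u $ k" for k
    using assms by (simp add: l_def u_def divide_strict_right_mono)
  have ne: "cbox l u \<noteq> {}"
    using lu by (auto simp: interval_ne_empty_cart less_imp_le)
  have "measure lebesgue (cbox l u) = (\<Prod>k\<in>UNIV. u $ k - l $ k)"
    using ne by (simp add: content_cbox_cart)
  also have "\<dots> = (\<Prod>k\<in>(UNIV::'d set). 1 / real J)"
    using assms by (intro prod.cong) (auto simp: l_def u_def diff_divide_distrib)
  also have "\<dots> = 1 / real J ^ CARD('d)"
    by (simp add: power_divide)
  finally have M: "measure lebesgue (cbox l u) = 1 / real J ^ CARD('d)" .
  have "box l u \<subseteq> cell J j"
  proof
    fix x assume "x \<in> box l u"
    then have "l $ k < x $ k" "x $ k < u $ k" for k
      by (simp_all add: mem_box_cart)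
    then show "x \<in> cell J j"
      by (intro in_cell) (simp_all add: l_def u_def less_imp_le)
  qed
  moreover have "cell J j \<subseteq> cbox l u"
    using cell_bounds[of _ J j] by (simp add: subset_eq mem_box_cart l_def u_def)
  moreover have "cell J j \<in> lmeasurable"
    using \<open>cell J j \<subseteq> cbox l u\<close> by (intro bounded_set_imp_lmeasurable bounded_subset[OF bounded_cbox]) auto
  ultimately have "measure lebesgue (box l u) \<le> measure lebesgue (cell J j)"
    "measure lebesgue (cell J j) \<le> measure lebesgue (cbox l u)"
    by (intro measure_mono_fmeasurable; simp)+
  moreover have "measure lebesgue (box l u) = measure lebesgue (cbox l u)"
    by (simp add: content_eq_0_interior measure_lborel_box_eq measure_lborel_cbox_eq)
  ultimately have "measure lebesgue (cell J j) = 1 / real J ^ CARD('d)"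
    using M by simp
  moreover have "measure (lebesgue_on unit_cube) (cell J j) = measure lebesgue (cell J j)"
    using cell_subset_cube[OF assms] by (subst measure_restrict_space) auto
  ultimately show ?thesis
    by simp
qed

lemma measurable_indicator_cell [measurable]:
  "(indicator (cell J j) :: _ \<Rightarrow> real) \<in> borel_measurable (lebesgue_on (unit_cube :: (real ^ 'd) set))"
proof -
  have "cell J j \<in> sets (lebesgue :: (real ^ 'd) measure)"
    by simp
  then have "(indicator (cell J j) :: _ \<Rightarrow> real) \<in> borel_measurable (lebesgue :: (real ^ 'd) measure)"
    by (rule borel_measurable_indicator)
  then show ?thesis
    by (rule measurable_restrict_space1)
qed

lemma integrable_indicator_cell:
  "integrable (lebesgue_on (unit_cube :: (real ^ 'd) set)) (\<lambda>x. indicator (cell J j) x :: real)"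
proof -
  interpret finite_measure "lebesgue_on (unit_cube :: (real ^ 'd) set)"
    by (rule finite_measure_cube)
  show ?thesis
    by (rule integrable_const_bound[where B = 1, OF _ measurable_indicator_cell])
      (simp add: indicator_def)
qed

lemma integral_indicator_cell:
  assumes "0 < J" "j \<in> (grid J :: (nat ^ 'd) set)"
  shows "(LINT x|lebesgue_on unit_cube. indicator (cell J j) x) = 1 / real J ^ CARD('d)"
proof -
  have "cell J j \<inter> space (lebesgue_on unit_cube) = cell J j"
    using cell_subset_cube[OF assms] by auto
  then show ?thesis
    using measure_cell[OF assms] by simp
qed

lemma histogram_in_cell:
  fixes x :: "real ^ 'd"
  assumes "0 < J" "j \<in> grid J" "x \<in> cell J j"
  shows "histogram J \<theta> x = real J ^ CARD('d) * \<theta> j"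
proof -
  have "(\<Sum>i\<in>grid J. \<theta> i * indicator (cell J i) x) = (\<Sum>i\<in>grid J. if i = j then \<theta> i else 0)"
    using cell_unique[OF assms(1)] assms by (intro sum.cong) (auto simp: indicator_def)
  then show ?thesis
    using assms by (simp add: histogram_def)
qed

lemma sum_cells_in_cell:
  fixes x :: "real ^ 'd"
  assumes "0 < J" "j \<in> grid J" "x \<in> cell J j"
  shows "(\<Sum>i\<in>grid J. \<theta> i * indicator (cell J i) x) = (\<theta> j :: real)"
  using histogram_in_cell[OF assms, of \<theta>] assms(1) by (simp add: histogram_def)

lemma integrable_histogram:
  "integrable (lebesgue_on (unit_cube :: (real ^ 'd) set)) (histogram J \<theta>)"
  unfolding histogram_def[abs_def]
  by (intro integrable_mult_right Bochner_Integration.integrable_sum integrable_indicator_cell)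

lemma integral_sum_cells:
  assumes "0 < J"
  shows "integrable (lebesgue_on (unit_cube :: (real ^ 'd) set)) (\<lambda>x. \<Sum>j\<in>grid J. w j * indicator (cell J j) x)"
    "(LINT x|lebesgue_on (unit_cube :: (real ^ 'd) set). (\<Sum>j\<in>grid J. w j * indicator (cell J j) x))
      = (\<Sum>j\<in>grid J. w j) / real J ^ CARD('d)"
proof -
  show "integrable (lebesgue_on (unit_cube :: (real ^ 'd) set)) (\<lambda>x. \<Sum>j\<in>grid J. w j * indicator (cell J j) x)"
    by (intro Bochner_Integration.integrable_sum integrable_mult_right integrable_indicator_cell)
  have "(LINT x|lebesgue_on (unit_cube :: (real ^ 'd) set). (\<Sum>j\<in>grid J. w j * indicator (cell J j) x))
    = (\<Sum>j\<in>grid J. (LINT x|lebesgue_on (unit_cube :: (real ^ 'd) set). w j * indicator (cell J j) x))"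
    by (intro Bochner_Integration.integral_sum integrable_mult_right integrable_indicator_cell)
  also have "\<dots> = (\<Sum>j\<in>(grid J :: (nat ^ 'd) set). w j * (1 / real J ^ CARD('d)))"
    by (intro sum.cong refl) (simp only: integral_mult_right_zero integral_indicator_cell[OF assms])
  finally show "(LINT x|lebesgue_on (unit_cube :: (real ^ 'd) set). (\<Sum>j\<in>grid J. w j * indicator (cell J j) x))
      = (\<Sum>j\<in>grid J. w j) / real J ^ CARD('d)"
    by (simp add: sum_divide_distrib)
qed

lemma L1_norm_le_cells:
  fixes f :: "real ^ 'd \<Rightarrow> real"
  assumes "0 < J" and le: "\<And>j x. j \<in> grid J \<Longrightarrow> x \<in> cell J j \<Longrightarrow> \<bar>f x\<bar> \<le> w j"
  shows "L1_norm f \<le> (\<Sum>j\<in>grid J. w j) / real J ^ CARD('d)"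
proof -
  have "L1_norm f \<le> (LINT x|lebesgue_on (unit_cube :: (real ^ 'd) set). (\<Sum>j\<in>grid J. w j * indicator (cell J j) x))"
    unfolding L1_norm_def
  proof (rule integral_mono_AE')
    have *: "AE x in lebesgue_on (unit_cube :: (real ^ 'd) set). \<bar>f x\<bar> \<le> (\<Sum>j\<in>grid J. w j * indicator (cell J j) x)"
      using AE_cube_cells[OF assms(1)]
    proof eventually_elim
      case (elim x)
      then obtain j where "j \<in> grid J" "x \<in> cell J j"
        by blast
      then show ?case
        using sum_cells_in_cell[OF assms(1), of j x w] le by simp
    qed
    then show "AE x in lebesgue_on unit_cube. \<bar>f x\<bar> \<le> (\<Sum>j\<in>grid J. w j * indicator (cell J j) x)" .
    from * show "AE x in lebesgue_on unit_cube. 0 \<le> (\<Sum>j\<in>grid J. w j * indicator (cell J j) x)"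
      by eventually_elim (use order_trans abs_ge_zero in blast)
  qed (rule integral_sum_cells[OF assms(1)])
  then show ?thesis
    by (simp only: integral_sum_cells[OF assms(1)])
qed

lemma L1_norm_histogram_diff:
  assumes "0 < J"
  shows "L1_norm (\<lambda>x :: real ^ 'd. histogram J \<theta> x - histogram J \<theta>' x) \<le> (\<Sum>j\<in>grid J. \<bar>\<theta> j - \<theta>' j\<bar>)"
proof -
  have "L1_norm (\<lambda>x :: real ^ 'd. histogram J \<theta> x - histogram J \<theta>' x)
    \<le> (\<Sum>j\<in>(grid J :: (nat ^ 'd) set). real J ^ CARD('d) * \<bar>\<theta> j - \<theta>' j\<bar>) / real J ^ CARD('d)"
  proof (rule L1_norm_le_cells[OF assms])
    fix j :: "nat ^ 'd" and x assume j: "j \<in> grid J" "x \<in> cell J j"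
    show "\<bar>histogram J \<theta> x - histogram J \<theta>' x\<bar> \<le> real J ^ CARD('d) * \<bar>\<theta> j - \<theta>' j\<bar>"
      by (simp add: histogram_in_cell[OF assms j] right_diff_distrib[symmetric] abs_mult)
  qed
  then show ?thesis
    using assms by (simp add: sum_distrib_left[symmetric])
qed

definition cell_mass :: "nat \<Rightarrow> (real ^ 'd \<Rightarrow> real) \<Rightarrow> nat ^ 'd \<Rightarrow> real" where
  "cell_mass J g j = (LINT x|lebesgue_on unit_cube. indicator (cell J j) x * g x)"

lemma integrable_cell_mult:
  assumes "integrable (lebesgue_on unit_cube) (g :: real ^ 'd \<Rightarrow> real)"
  shows "integrable (lebesgue_on unit_cube) (\<lambda>x. indicator (cell J j) x * g x)"
proof (rule Bochner_Integration.integrable_bound[OF assms])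
  show "(\<lambda>x. indicator (cell J j) x * g x) \<in> borel_measurable (lebesgue_on unit_cube)"
    using assms by (intro borel_measurable_times measurable_indicator_cell borel_measurable_integrable)
qed (simp add: indicator_def)

lemma sum_cell_mass:
  assumes "0 < J" and int: "integrable (lebesgue_on unit_cube) (g :: real ^ 'd \<Rightarrow> real)"
  shows "(\<Sum>j\<in>grid J. cell_mass J g j) = (LINT x|lebesgue_on unit_cube. g x)"
proof -
  have "(\<Sum>j\<in>grid J. cell_mass J g j) = (LINT x|lebesgue_on unit_cube. (\<Sum>j\<in>grid J. indicator (cell J j) x * g x))"
    unfolding cell_mass_def by (intro Bochner_Integration.integral_sum[symmetric] integrable_cell_mult int)
  also have "\<dots> = (LINT x|lebesgue_on unit_cube. g x)"
  proof (rule integral_cong_AE)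
    show "AE x in lebesgue_on unit_cube. (\<Sum>j\<in>grid J. indicator (cell J j) x * g x) = g x"
      using AE_cube_cells[OF assms(1)]
    proof eventually_elim
      case (elim x)
      then obtain j where "j \<in> grid J" "x \<in> cell J j"
        by blast
      then show ?case
        using sum_cells_in_cell[OF assms(1), of j x "\<lambda>_. g x"] by (simp add: mult.commute)
    qed
  next
    show "(\<lambda>x. \<Sum>j\<in>grid J. indicator (cell J j) x * g x) \<in> borel_measurable (lebesgue_on unit_cube)"
      by (intro borel_measurable_integrable Bochner_Integration.integrable_sum integrable_cell_mult int)
  qed (rule borel_measurable_integrable[OF int])
  finally show ?thesis .
qed

text \<open>
  A function differs from its average over a cell by at most its oscillation on the cell, and all cells have
  volume $J^{-d}$.
\<close>

lemma L1_projection_le_oscillation: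
  fixes f :: "real ^ 'd \<Rightarrow> real"
  assumes "0 < J" and int: "integrable (lebesgue_on unit_cube) f"
    and osc: "\<And>j x y. j \<in> grid J \<Longrightarrow> x \<in> cell J j \<Longrightarrow> y \<in> cell J j \<Longrightarrow> \<bar>f x - f y\<bar> \<le> w j"
  shows "L1_norm (\<lambda>x. f x - histogram J (cell_mass J f) x) \<le> (\<Sum>j\<in>grid J. w j) / real J ^ CARD('d)"
proof (rule L1_norm_le_cells[OF assms(1)])
  fix j :: "nat ^ 'd" and x assume j: "j \<in> grid J" "x \<in> cell J j"
  let ?I = "indicator (cell J j) :: real ^ 'd \<Rightarrow> real"
  have I: "(LINT y|lebesgue_on unit_cube. ?I y) = 1 / real J ^ CARD('d)"
    by (rule integral_indicator_cell[OF assms(1) j(1)])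
  note ints = integrable_cell_mult[OF int, of J j] integrable_indicator_cell[of J j]
  have "\<bar>f x * (1 / real J ^ CARD('d)) - cell_mass J f j\<bar>
    = \<bar>(LINT y|lebesgue_on unit_cube. f x * ?I y - ?I y * f y)\<bar>"
    using ints unfolding cell_mass_def I[symmetric]
    by (subst Bochner_Integration.integral_diff) (auto simp del: integral_indicator)
  also have "\<dots> \<le> (LINT y|lebesgue_on unit_cube. \<bar>f x * ?I y - ?I y * f y\<bar>)"
    by (rule integral_abs_bound)
  also have "\<dots> \<le> (LINT y|lebesgue_on unit_cube. w j * ?I y)"
    using ints osc[OF j] by (intro integral_mono) (auto simp: indicator_def)
  also have "\<dots> = w j / real J ^ CARD('d)"
    using I by (simp del: integral_indicator)
  finally have "real J ^ CARD('d) * \<bar>f x * (1 / real J ^ CARD('d)) - cell_mass J f j\<bar> \<le> w j"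
    using assms(1) by (simp add: field_simps)
  also have "real J ^ CARD('d) * \<bar>f x * (1 / real J ^ CARD('d)) - cell_mass J f j\<bar>
    = \<bar>real J ^ CARD('d) * (f x * (1 / real J ^ CARD('d)) - cell_mass J f j)\<bar>"
    by (simp add: abs_mult)
  also have "real J ^ CARD('d) * (f x * (1 / real J ^ CARD('d)) - cell_mass J f j)
    = f x - histogram J (cell_mass J f) x"
    using assms(1) by (simp add: histogram_in_cell[OF assms(1) j] right_diff_distrib)
  finally show "\<bar>f x - histogram J (cell_mass J f) x\<bar> \<le> w j" .
qed

section \<open>Coordinatewise decreasing functions\<close>

definition lower_corner :: "nat \<Rightarrow> nat ^ 'd \<Rightarrow> real ^ 'd" where
  "lower_corner J j = (\<chi> k. (real (j $ k) - 1) / real J)"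

definition upper_corner :: "nat \<Rightarrow> nat ^ 'd \<Rightarrow> real ^ 'd" where
  "upper_corner J j = (\<chi> k. real (j $ k) / real J)"

lemma corners_in_cube:
  assumes "0 < J" "j \<in> grid J"
  shows "lower_corner J j \<in> unit_cube" "upper_corner J j \<in> unit_cube"
proof -
  have "real (j $ k) \<le> real J" "1 \<le> real (j $ k)" for k
    using assms by (auto simp: grid_def)
  then have "0 \<le> real (j $ k) - 1" "real (j $ k) - 1 \<le> real J" "real (j $ k) \<le> real J" "0 \<le> real (j $ k)" for k
    by (smt (verit))+
  then show "lower_corner J j \<in> unit_cube" "upper_corner J j \<in> unit_cube"
    using assms by (auto simp: unit_cube_def lower_corner_def upper_corner_def)
qed

text \<open>
  The sums of $F$ over the grid and over the grid shifted by one along the diagonal share all terms except those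
  on two boundary layers of $J^d - (J-1)^d$ points each. With $F$ a decreasing function sampled on the grid this says
  that its oscillations over the cells add up to a quantity of order $J^{d-1}$ instead of $J^d$.
\<close>

lemma sum_shifted_difference_le:
  fixes F :: "nat ^ 'd \<Rightarrow> real"
  assumes "0 < J" and bd: "\<And>v. (\<forall>k. v $ k \<le> J) \<Longrightarrow> l \<le> F v \<and> F v \<le> h"
  shows "(\<Sum>j\<in>grid J. F (\<chi> k. j $ k - 1) - F j) \<le> (real J ^ CARD('d) - real (J - 1) ^ CARD('d)) * (h - l)"
proof -
  let ?V = "\<lambda>S. {v :: nat ^ 'd. \<forall>k. v $ k \<in> S}"
  let ?m = "real J ^ CARD('d) - real (J - 1) ^ CARD('d)"
  have fin: "finite (?V {..<J})" "finite (?V {1..J})"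
    by (rule card_vec_set, simp)+
  have shift: "(\<Sum>j\<in>grid J. F (\<chi> k. j $ k - 1)) = (\<Sum>j\<in>?V {..<J}. F j)"
    by (rule sum.reindex_bij_witness[where j = "\<lambda>j. (\<chi> k. j $ k - 1)" and i = "\<lambda>j. (\<chi> k. j $ k + 1)"])
      (auto simp: grid_eq vec_eq_iff Suc_le_eq, (metis Suc_leI Suc_le_lessD Suc_pred less_Suc_eq_le)+)
  have sub: "?V {1..<J} \<subseteq> ?V {..<J}" "?V {1..<J} \<subseteq> ?V {1..J}"
    by (auto simp: less_imp_le)
  have cards: "real (card (?V {..<J} - ?V {1..<J})) = ?m" "real (card (?V {1..J} - ?V {1..<J})) = ?m"
  proof -
    have "finite (?V {1..<J})"
      by (rule card_vec_set) simp
    then have "card (?V {..<J} - ?V {1..<J}) = J ^ CARD('d) - (J - 1) ^ CARD('d)"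
      "card (?V {1..J} - ?V {1..<J}) = J ^ CARD('d) - (J - 1) ^ CARD('d)"
      using sub by (simp_all only: card_Diff_subset card_vec_set finite_lessThan finite_atLeastAtMost
          finite_atLeastLessThan card_lessThan card_atLeastAtMost card_atLeastLessThan diff_Suc_1 Suc_eq_plus1[symmetric])
    moreover have "(J - 1) ^ CARD('d) \<le> J ^ CARD('d)"
      by (intro power_mono) auto
    ultimately show "real (card (?V {..<J} - ?V {1..<J})) = ?m" "real (card (?V {1..J} - ?V {1..<J})) = ?m"
      by (simp_all add: of_nat_diff)
  qed
  have "(\<Sum>j\<in>?V {..<J}. F j) = (\<Sum>j\<in>?V {..<J} - ?V {1..<J}. F j) + (\<Sum>j\<in>?V {1..<J}. F j)"
    using sub fin by (intro sum.subset_diff)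
  also have "(\<Sum>j\<in>?V {..<J} - ?V {1..<J}. F j) \<le> ?m * h"
    unfolding cards(1)[symmetric] using bd by (intro sum_bounded_above) (auto simp: less_imp_le)
  finally have up: "(\<Sum>j\<in>?V {..<J}. F j) \<le> ?m * h + (\<Sum>j\<in>?V {1..<J}. F j)"
    by simp
  have "?m * l \<le> (\<Sum>j\<in>?V {1..J} - ?V {1..<J}. F j)"
    unfolding cards(2)[symmetric] using bd by (intro sum_bounded_below) auto
  also have "\<dots> + (\<Sum>j\<in>?V {1..<J}. F j) = (\<Sum>j\<in>?V {1..J}. F j)"
    using sub fin by (intro sum.subset_diff[symmetric])
  finally have "?m * l + (\<Sum>j\<in>?V {1..<J}. F j) \<le> (\<Sum>j\<in>?V {1..J}. F j)"
    by simp
  then have "(\<Sum>j\<in>?V {..<J}. F j) - (\<Sum>j\<in>?V {1..J}. F j) \<le> ?m * (h - l)"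
    using up by (simp only: right_diff_distrib)
  then show ?thesis
    by (simp only: sum_subtractf shift[unfolded grid_eq] grid_eq)
qed

lemma boundary_cells_le:
  assumes "0 < J"
  shows "(real J ^ n - real (J - 1) ^ n) / real J ^ n \<le> real n / real J"
proof -
  have "1 + real n * (- 1 / real J) \<le> (1 + (- 1 / real J)) ^ n"
    using assms by (intro Bernoulli_inequality) simp
  also have "1 + (- 1 / real J) = real (J - 1) / real J"
    using assms by (simp add: of_nat_diff field_simps)
  finally have "1 - real (J - 1) ^ n / real J ^ n \<le> real n / real J"
    by (simp add: power_divide)
  then show ?thesis
    using assms by (simp add: diff_divide_distrib)
qed

lemma Fstar_bounds:
  assumes "f \<in> Fstar" "x \<in> unit_cube"
  shows "f 1 \<le> f x" "f x \<le> f 0"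
proof -
  have "(0 :: real ^ 'd) \<in> unit_cube" "(1 :: real ^ 'd) \<in> unit_cube" "0 \<le> x" "x \<le> 1"
    using assms(2) by (auto simp: unit_cube_def less_eq_vec_def)
  then show "f 1 \<le> f x" "f x \<le> f 0"
    using assms unfolding Fstar_def by blast+
qed

lemma Fstar_cell_bounds:
  assumes "f \<in> Fstar" "0 < J" "j \<in> grid J" "x \<in> cell J j"
  shows "f (upper_corner J j) \<le> f x" "f x \<le> f (lower_corner J j)"
proof -
  have "x \<in> unit_cube"
    using cell_subset_cube assms by blast
  moreover have "lower_corner J j \<le> x" "x \<le> upper_corner J j"
    using cell_bounds[OF assms(4)] by (auto simp: less_eq_vec_def lower_corner_def upper_corner_def)
  ultimately show "f (upper_corner J j) \<le> f x" "f x \<le> f (lower_corner J j)"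
    using assms(1) corners_in_cube[OF assms(2,3)] unfolding Fstar_def by blast+
qed

lemma Fstar_corner_sum:
  fixes f :: "real ^ 'd \<Rightarrow> real"
  assumes "f \<in> Fstar" "0 < J"
  shows "(\<Sum>j\<in>grid J. f (lower_corner J j) - f (upper_corner J j)) / real J ^ CARD('d)
    \<le> real CARD('d) * (f 0 - f 1) / real J"
proof -
  let ?F = "\<lambda>v :: nat ^ 'd. f (\<chi> k. real (v $ k) / real J)"
  have lower: "lower_corner J j = (\<chi> k. real ((\<chi> k. j $ k - 1) $ k) / real J)" if "j \<in> grid J" for j :: "nat ^ 'd"
    using that by (auto simp: lower_corner_def grid_def vec_eq_iff of_nat_diff)
  have "(\<Sum>j\<in>grid J. f (lower_corner J j) - f (upper_corner J j))
    = (\<Sum>j\<in>grid J. ?F (\<chi> k. j $ k - 1) - ?F j)"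
    using lower by (intro sum.cong refl) (simp add: upper_corner_def)
  also have "\<dots> \<le> (real J ^ CARD('d) - real (J - 1) ^ CARD('d)) * (f 0 - f 1)"
  proof (rule sum_shifted_difference_le[OF assms(2)])
    fix v :: "nat ^ 'd" assume v: "\<forall>k. v $ k \<le> J"
    have "(\<chi> k. real (v $ k) / real J) \<in> unit_cube"
      using v assms(2) by (auto simp: unit_cube_def)
    then show "f 1 \<le> ?F v \<and> ?F v \<le> f 0"
      using Fstar_bounds[OF assms(1)] by blast
  qed
  finally have "(\<Sum>j\<in>grid J. f (lower_corner J j) - f (upper_corner J j)) / real J ^ CARD('d)
    \<le> (real J ^ CARD('d) - real (J - 1) ^ CARD('d)) * (f 0 - f 1) / real J ^ CARD('d)"
    by (rule divide_right_mono) simp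
  also have "\<dots> = (real J ^ CARD('d) - real (J - 1) ^ CARD('d)) / real J ^ CARD('d) * (f 0 - f 1)"
    by simp
  also have "\<dots> \<le> real CARD('d) / real J * (f 0 - f 1)"
  proof (rule mult_right_mono[OF boundary_cells_le[OF assms(2)]])
    have "(1 :: real ^ 'd) \<in> unit_cube"
      by (simp add: unit_cube_def)
    then show "0 \<le> f 0 - f 1"
      using Fstar_bounds(2)[OF assms(1)] by simp
  qed
  finally show ?thesis
    by simp
qed

text \<open>
  A decreasing function is squeezed between the step functions that take its values at the upper and at the lower
  corners of the cells, and the integrals of these differ by $O(1/J)$. Lebesgue measurability is essential for the
  distances to \<^term>\<open>Fstar\<close>: a candidate that is not integrable could count as being at distance
  $0$ from every integrable function, since the Bochner integral is $0$ by convention where it does not exist.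
\<close>

lemma integrable_Fstar:
  fixes f :: "real ^ 'd \<Rightarrow> real"
  assumes f: "f \<in> Fstar"
  shows "integrable (lebesgue_on unit_cube) f"
proof -
  define S where "S = {x \<in> (unit_cube :: (real ^ 'd) set). \<forall>k. x $ k \<noteq> 0}"
  have neg: "negligible (S - unit_cube)" "negligible (unit_cube - S)"
    by (auto simp: S_def intro: negligible_subset[OF negligible_coordinate_hyperplanes])
  have to_S: "(h has_integral (LINT x|lebesgue_on unit_cube. h x)) S"
    if "integrable (lebesgue_on unit_cube) h" for h :: "real ^ 'd \<Rightarrow> real"
  proof -
    have "(h has_integral (LINT x|lebesgue_on unit_cube. h x)) unit_cube"
      by (rule has_integral_integral_lebesgue_on[OF that sets_unit_cube])
    then show ?thesis
      by (rule has_integral_spike_set_eq[THEN iffD1, rotated -1])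
        (auto intro: negligible_subset[OF neg(1)] negligible_subset[OF neg(2)])
  qed
  have "f integrable_on S"
  proof (rule integrable_straddle)
    fix e :: real assume e: "0 < e"
    obtain J where J: "real CARD('d) * (f 0 - f 1) / e < real J" "0 < J"
      using reals_Archimedean2[of "max 0 (real CARD('d) * (f 0 - f 1) / e)"] by auto
    let ?g = "\<lambda>x. \<Sum>j\<in>grid J. f (upper_corner J j) * indicator (cell J j) x"
    let ?h = "\<lambda>x. \<Sum>j\<in>grid J. f (lower_corner J j) * indicator (cell J j) x"
    let ?i = "\<lambda>c. (\<Sum>j\<in>grid J. f (c J j)) / real J ^ CARD('d)"
    note int = integral_sum_cells[OF J(2), where 'd = 'd]
    have gh: "(?g has_integral ?i upper_corner) S" "(?h has_integral ?i lower_corner) S"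
      using to_S[OF int(1), of "\<lambda>j. f (upper_corner J j)"] to_S[OF int(1), of "\<lambda>j. f (lower_corner J j)"]
      by (simp_all only: int(2))
    have le: "?g x \<le> f x \<and> f x \<le> ?h x" if x: "x \<in> S" for x
    proof -
      obtain j where j: "j \<in> grid J" "x \<in> cell J j"
        using cells_cover[OF J(2), of x] x by (auto simp: S_def)
      then show ?thesis
        using Fstar_cell_bounds[OF f J(2) j]
        by (simp only: sum_cells_in_cell[OF J(2) j, of "\<lambda>j. f (upper_corner J j)"]
            sum_cells_in_cell[OF J(2) j, of "\<lambda>j. f (lower_corner J j)"])
    qed
    have "0 \<le> (\<Sum>j\<in>grid J. f (lower_corner J (j :: nat ^ 'd)) - f (upper_corner J j))"
    proof (rule sum_nonneg)
      fix j :: "nat ^ 'd" assume j: "j \<in> grid J"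
      have "upper_corner J j \<in> cell J j"
        using J(2) by (intro in_cell) (auto simp: upper_corner_def divide_strict_right_mono)
      then show "0 \<le> f (lower_corner J j) - f (upper_corner J j)"
        using Fstar_cell_bounds[OF f J(2) j] by force
    qed
    moreover have "?i lower_corner - ?i upper_corner < e"
    proof -
      have "?i lower_corner - ?i upper_corner \<le> real CARD('d) * (f 0 - f 1) / real J"
        using Fstar_corner_sum[OF f J(2)] by (simp add: sum_subtractf diff_divide_distrib)
      also have "\<dots> < e"
        using J e by (simp add: field_simps)
      finally show ?thesis .
    qed
    ultimately have "\<bar>?i upper_corner - ?i lower_corner\<bar> < e"
      by (simp add: sum_subtractf divide_right_mono)
    then show "\<exists>g h i j. (g has_integral i) S \<and> (h has_integral j) S \<and> \<bar>i - j\<bar> < e \<and> (\<forall>x\<in>S. g x \<le> f x \<and> f x \<le> h x)"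
      using gh le by blast
  qed
  then have "f integrable_on unit_cube"
    by (rule integrable_spike_set_eq[THEN iffD1, rotated]) (auto intro: negligible_Un neg)
  moreover have "norm (f x) \<le> \<bar>f 0\<bar> + \<bar>f 1\<bar>" if "x \<in> unit_cube" for x
    using Fstar_bounds[OF f that] by auto
  ultimately have "f absolutely_integrable_on unit_cube"
    by (intro absolutely_integrable_integrable_bound[where g = "\<lambda>_. \<bar>f 0\<bar> + \<bar>f 1\<bar>"])
      (auto simp: unit_cube_eq_cbox)
  then show ?thesis
    by (rule absolutely_integrable_imp_integrable) simp
qed

lemma L1_projection_Fstar:
  fixes f :: "real ^ 'd \<Rightarrow> real"
  assumes f: "f \<in> Fstar" and J: "0 < J"
  shows "L1_norm (\<lambda>x. f x - histogram J (cell_mass J f) x) \<le> real CARD('d) * (f 0 - f 1) / real J"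
proof -
  have "L1_norm (\<lambda>x. f x - histogram J (cell_mass J f) x)
    \<le> (\<Sum>j\<in>grid J. f (lower_corner J j) - f (upper_corner J j)) / real J ^ CARD('d)"
  proof (rule L1_projection_le_oscillation[OF J integrable_Fstar[OF f]])
    fix j :: "nat ^ 'd" and x y assume "j \<in> grid J" "x \<in> cell J j" "y \<in> cell J j"
    then show "\<bar>f x - f y\<bar> \<le> f (lower_corner J j) - f (upper_corner J j)"
      using Fstar_cell_bounds[OF f J, of j x] Fstar_cell_bounds[OF f J, of j y] by auto
  qed
  also note Fstar_corner_sum[OF f J]
  finally show ?thesis .
qed

lemma L1_norm_nonneg: "0 \<le> L1_norm f"
  by (simp add: L1_norm_def)

lemma L1_norm_triangle:
  assumes "integrable (lebesgue_on unit_cube) f" "integrable (lebesgue_on unit_cube) g"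
    "integrable (lebesgue_on unit_cube) h"
  shows "L1_norm (\<lambda>x. f x - h x) \<le> L1_norm (\<lambda>x. f x - g x) + L1_norm (\<lambda>x. g x - h x)"
proof -
  have "L1_norm (\<lambda>x. f x - h x) \<le> (LINT x|lebesgue_on unit_cube. \<bar>f x - g x\<bar> + \<bar>g x - h x\<bar>)"
    unfolding L1_norm_def using assms by (intro integral_mono) auto
  also have "\<dots> = L1_norm (\<lambda>x. f x - g x) + L1_norm (\<lambda>x. g x - h x)"
    unfolding L1_norm_def using assms by (intro Bochner_Integration.integral_add) auto
  finally show ?thesis .
qed

lemma d1_le:
  assumes "s \<in> S"
  shows "d1 f S \<le> L1_norm (\<lambda>x. f x - s x)"
  unfolding d1_def by (rule cINF_lower[OF _ assms]) (auto intro!: bdd_belowI[of _ 0] L1_norm_nonneg)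

lemma d1_greatest:
  assumes "S \<noteq> {}" "\<And>s. s \<in> S \<Longrightarrow> c \<le> L1_norm (\<lambda>x. f x - s x)"
  shows "c \<le> d1 f S"
  unfolding d1_def using assms by (rule cINF_greatest)

lemma Fstar_nonempty: "Fstar \<noteq> {}"
proof -
  have "(\<lambda>_. 0) \<in> Fstar"
    by (simp add: Fstar_def)
  then show ?thesis
    by blast
qed

lemma d1_Fstar_triangle:
  assumes "integrable (lebesgue_on unit_cube) f" "integrable (lebesgue_on unit_cube) g"
  shows "d1 f Fstar \<le> L1_norm (\<lambda>x. f x - g x) + d1 g Fstar"
proof -
  have "d1 f Fstar - L1_norm (\<lambda>x. f x - g x) \<le> d1 g Fstar"
  proof (rule d1_greatest[OF Fstar_nonempty])
    fix s :: "real ^ 'a \<Rightarrow> real" assume s: "s \<in> Fstar"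
    show "d1 f Fstar - L1_norm (\<lambda>x. f x - g x) \<le> L1_norm (\<lambda>x. g x - s x)"
      using d1_le[OF s, of f] L1_norm_triangle[OF assms integrable_Fstar[OF s]] by simp
  qed
  then show ?thesis
    by simp
qed

lemma L1_norm_commute: "L1_norm (\<lambda>x. f x - g x) = L1_norm (\<lambda>x. g x - f x)"
  by (simp add: L1_norm_def abs_minus_commute)

text \<open>
  A Lipschitz function of finitely many coordinates is below $c$ at $x$ iff some rational point close to $x$
  witnesses this, so its sublevel sets are countable unions of measurable sets. This makes the event that the
  random histogram is nearly decreasing measurable.
\<close>

lemma borel_measurable_PiM_Lipschitz:
  fixes F :: "('i \<Rightarrow> real) \<Rightarrow> real"
  assumes fin: "finite I" and lip: "\<And>x y. F x \<le> (\<Sum>i\<in>I. \<bar>x i - y i\<bar>) + F y"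
  shows "F \<in> borel_measurable (\<Pi>\<^sub>M i\<in>I. borel)"
  unfolding borel_measurable_iff_less
proof
  fix c :: real
  let ?M = "\<Pi>\<^sub>M i\<in>I. borel :: real measure"
  let ?Q = "\<Pi>\<^sub>E i\<in>I. \<rat> :: real set"
  have "{x \<in> space ?M. F x < c} = (\<Union>q\<in>?Q. {x \<in> space ?M. (\<Sum>i\<in>I. \<bar>x i - q i\<bar>) + F q < c})"
  proof (intro equalityI subsetI)
    fix x assume "x \<in> {x \<in> space ?M. F x < c}"
    then have x: "x \<in> space ?M" "F x < c"
      by auto
    \<comment> \<open>The Lipschitz bound is used twice, once in F q and once in the distance, hence the factor 2.\<close>
    define e where "e = (c - F x) / (2 * (real (card I) + 1))"
    have e: "0 < e"
      using x by (simp add: e_def)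
    have "\<exists>r\<in>\<rat>. \<bar>x i - r\<bar> < e" for i
    proof -
      obtain r where "r \<in> \<rat>" "x i < r" "r < x i + e"
        using Rats_dense_in_real[of "x i" "x i + e"] e by auto
      then show ?thesis
        by (intro bexI[of _ r]) auto
    qed
    then obtain r where r: "r i \<in> \<rat>" "\<bar>x i - r i\<bar> < e" for i
      by metis
    define q where "q = restrict r I"
    have "(\<Sum>i\<in>I. \<bar>x i - q i\<bar>) \<le> real (card I) * e"
      using r by (intro sum_bounded_above) (auto simp: q_def less_imp_le)
    moreover have "2 * (real (card I) * e) < c - F x"
      using x e unfolding e_def by (simp add: field_simps)
    ultimately have "2 * (\<Sum>i\<in>I. \<bar>x i - q i\<bar>) < c - F x"
      by linarith
    moreover have "F q \<le> (\<Sum>i\<in>I. \<bar>x i - q i\<bar>) + F x"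
      using lip[of q x] by (simp add: abs_minus_commute)
    ultimately have "(\<Sum>i\<in>I. \<bar>x i - q i\<bar>) + F q < c"
      by linarith
    moreover have "q \<in> ?Q"
      using r by (auto simp: q_def)
    ultimately show "x \<in> (\<Union>q\<in>?Q. {x \<in> space ?M. (\<Sum>i\<in>I. \<bar>x i - q i\<bar>) + F q < c})"
      using x by blast
  next
    fix x assume "x \<in> (\<Union>q\<in>?Q. {x \<in> space ?M. (\<Sum>i\<in>I. \<bar>x i - q i\<bar>) + F q < c})"
    then obtain q where "x \<in> space ?M" "(\<Sum>i\<in>I. \<bar>x i - q i\<bar>) + F q < c"
      by blast
    then show "x \<in> {x \<in> space ?M. F x < c}"
      using lip[of x q] by simp
  qed
  also have "\<dots> \<in> sets ?M"
  proof (rule sets.countable_UN'')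
    show "countable ?Q"
      using fin by (intro countable_PiE countable_rat)
    fix q assume "q \<in> ?Q"
    show "{x \<in> space ?M. (\<Sum>i\<in>I. \<bar>x i - q i\<bar>) + F q < c} \<in> sets ?M"
      by measurable
  qed
  finally show "{x \<in> space ?M. F x < c} \<in> sets ?M" .
qed

lemma d1_histogram_measurable:
  assumes "0 < J"
  shows "(\<lambda>\<theta>. d1 (histogram J \<theta> :: real ^ 'd \<Rightarrow> real) Fstar) \<in> borel_measurable (\<Pi>\<^sub>M j\<in>grid J. borel)"
proof (rule borel_measurable_PiM_Lipschitz[OF finite_grid])
  fix \<theta> \<theta>' :: "nat ^ 'd \<Rightarrow> real"
  show "d1 (histogram J \<theta> :: real ^ 'd \<Rightarrow> real) Fstar
    \<le> (\<Sum>j\<in>grid J. \<bar>\<theta> j - \<theta>' j\<bar>) + d1 (histogram J \<theta>' :: real ^ 'd \<Rightarrow> real) Fstar"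
    using d1_Fstar_triangle[OF integrable_histogram integrable_histogram, of J \<theta> J \<theta>']
      L1_norm_histogram_diff[OF assms, of \<theta> \<theta>'] by linarith
qed

lemma Gstar_subset_Fstar: "Gstar \<subseteq> Fstar"
  by (auto simp: Gstar_def)

lemma Gstar_nonempty: "(\<lambda>_ :: real ^ 'd. 1) \<in> Gstar"
  using measure_unit_cube by (simp add: Gstar_def Fstar_def)

text \<open>
  For a decreasing \<open>s\<close>, the positive part \<open>p\<close> of \<open>s\<close> is at least as close to the
  nonnegative \<open>g\<close>, and its integral \<open>c\<close> differs from $1 = \int g$ by at most that distance. Rescaling
  \<open>p\<close> to integral one moves it by exactly \<open>\<bar>1 - c\<bar>\<close>, which doubles the distance at most.
\<close>

lemma d1_Gstar_le:
  fixes g :: "real ^ 'd \<Rightarrow> real"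
  assumes g: "g \<in> densities"
  shows "d1 g Gstar \<le> 2 * d1 g Fstar"
proof -
  let ?M = "lebesgue_on (unit_cube :: (real ^ 'd) set)"
  have gi: "integrable ?M g" and g0: "\<And>x. x \<in> unit_cube \<Longrightarrow> 0 \<le> g x" and g1: "(LINT x|?M. g x) = 1"
    using g by (auto simp: densities_def)
  have "d1 g Gstar / 2 \<le> d1 g Fstar"
  proof (rule d1_greatest[OF Fstar_nonempty])
    fix s :: "real ^ 'd \<Rightarrow> real" assume s: "s \<in> Fstar"
    define p where "p = (\<lambda>x. max 0 (s x))"
    define c where "c = (LINT x|?M. p x)"
    have p: "p \<in> Fstar"
      using s by (force simp: p_def Fstar_def)
    note pi = integrable_Fstar[OF p]
    have gp: "L1_norm (\<lambda>x. g x - p x) \<le> L1_norm (\<lambda>x. g x - s x)"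
      unfolding L1_norm_def using gi pi integrable_Fstar[OF s]
      by (intro integral_mono) (auto simp: p_def max_def dest: g0)
    have "\<bar>1 - c\<bar> = \<bar>LINT x|?M. g x - p x\<bar>"
      using gi pi g1 by (simp add: c_def)
    also have "\<dots> \<le> L1_norm (\<lambda>x. g x - p x)"
      unfolding L1_norm_def by (rule integral_abs_bound)
    finally have c1: "\<bar>1 - c\<bar> \<le> L1_norm (\<lambda>x. g x - p x)" .
    have c0: "0 \<le> c"
      unfolding c_def by (rule Bochner_Integration.integral_nonneg) (simp add: p_def)
    have "\<exists>t\<in>Gstar. L1_norm (\<lambda>x. p x - t x) \<le> \<bar>1 - c\<bar>"
    proof (cases "c = 0")
      case True
      \<comment> \<open>Here p vanishes almost everywhere, and the uniform density serves as the decreasing density.\<close>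
      have "L1_norm (\<lambda>x. p x - 1) \<le> (LINT x|?M. p x + 1)"
        unfolding L1_norm_def
        using pi finite_measure.integrable_const[OF finite_measure_cube, of "1::real"]
        by (intro integral_mono) (auto simp: p_def)
      also have "\<dots> = 1"
        using pi finite_measure.integrable_const[OF finite_measure_cube, of "1::real"] True measure_unit_cube
        by (subst Bochner_Integration.integral_add) (auto simp: c_def)
      finally show ?thesis
        using True Gstar_nonempty by (intro bexI[of _ "\<lambda>_. 1"]) auto
    next
      case False
      then have c: "0 < c"
        using c0 by simp
      define t where "t = (\<lambda>x. p x / c)"
      have "t \<in> Gstar"
        using p c by (auto simp: t_def Gstar_def Fstar_def divide_right_mono p_def[symmetric] c_def[symmetric])
          (simp_all add: p_def)
      moreover have "L1_norm (\<lambda>x. p x - t x) = \<bar>1 - c\<bar>"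
      proof -
        have "\<bar>p x - t x\<bar> = \<bar>1 - 1 / c\<bar> * p x" for x
        proof -
          have "p x - t x = (1 - 1 / c) * p x"
            by (simp add: t_def algebra_simps)
          then show ?thesis
            by (simp add: abs_mult) (simp add: p_def)
        qed
        then have "L1_norm (\<lambda>x. p x - t x) = \<bar>1 - 1 / c\<bar> * c"
          by (simp add: L1_norm_def c_def)
        also have "\<dots> = \<bar>(1 - 1 / c) * c\<bar>"
          using c by (simp add: abs_mult)
        also have "(1 - 1 / c) * c = c - 1"
          using c by (simp add: algebra_simps)
        finally show ?thesis
          by simp
      qed
      ultimately show ?thesis
        by (intro bexI[of _ t]) simp_all
    qed
    then obtain t where t: "t \<in> Gstar" "L1_norm (\<lambda>x. p x - t x) \<le> \<bar>1 - c\<bar>"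
      by blast
    then have ti: "integrable ?M t"
      using integrable_Fstar Gstar_subset_Fstar by blast
    show "d1 g Gstar / 2 \<le> L1_norm (\<lambda>x. g x - s x)"
      using d1_le[OF t(1), of g] L1_norm_triangle[OF gi pi ti] t(2) c1 gp by linarith
  qed
  then show ?thesis
    by simp
qed

section \<open>Approximation by cellwise averages\<close>

lemma norm_cell_diff_le:
  fixes x y :: "real ^ 'd"
  assumes "x \<in> cell J j" "y \<in> cell J j"
  shows "norm (x - y) \<le> real CARD('d) / real J"
proof -
  have "norm (x - y) \<le> (\<Sum>k\<in>UNIV. \<bar>(x - y) $ k\<bar>)"
    by (rule norm_le_l1_cart)
  also have "\<dots> \<le> real CARD('d) * (1 / real J)"
  proof (rule sum_bounded_above)
    fix k :: 'd
    show "\<bar>(x - y) $ k\<bar> \<le> 1 / real J"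
      using cell_bounds[OF assms(1), of k] cell_bounds[OF assms(2), of k] by (simp add: diff_divide_distrib)
  qed
  finally show ?thesis
    by simp
qed

lemma L1_projection_uniform:
  fixes f :: "real ^ 'd \<Rightarrow> real"
  assumes J: "0 < J" and int: "integrable (lebesgue_on unit_cube) f"
    and mod: "\<And>x y. x \<in> unit_cube \<Longrightarrow> y \<in> unit_cube \<Longrightarrow> norm (x - y) \<le> real CARD('d) / real J \<Longrightarrow> \<bar>f x - f y\<bar> \<le> w"
  shows "L1_norm (\<lambda>x. f x - histogram J (cell_mass J f) x) \<le> w"
proof -
  have "L1_norm (\<lambda>x. f x - histogram J (cell_mass J f) x) \<le> (\<Sum>j\<in>(grid J :: (nat ^ 'd) set). w) / real J ^ CARD('d)"
  proof (rule L1_projection_le_oscillation[OF J int])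
    fix j :: "nat ^ 'd" and x y assume j: "j \<in> grid J" "x \<in> cell J j" "y \<in> cell J j"
    then have "x \<in> unit_cube" "y \<in> unit_cube"
      using cell_subset_cube[OF J] by blast+
    then show "\<bar>f x - f y\<bar> \<le> w"
      using mod norm_cell_diff_le j by blast
  qed
  then show ?thesis
    using J by (simp add: card_grid)
qed

lemma L1_projection_contraction:
  fixes f h :: "real ^ 'd \<Rightarrow> real"
  assumes J: "0 < J" and int: "integrable (lebesgue_on unit_cube) f" "integrable (lebesgue_on unit_cube) h"
  shows "L1_norm (\<lambda>x. histogram J (cell_mass J f) x - histogram J (cell_mass J h) x) \<le> L1_norm (\<lambda>x. f x - h x)"
proof -
  have fh: "integrable (lebesgue_on unit_cube) (\<lambda>x. \<bar>f x - h x\<bar>)"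
    using int by simp
  have "L1_norm (\<lambda>x. histogram J (cell_mass J f) x - histogram J (cell_mass J h) x)
    \<le> (\<Sum>j\<in>grid J. \<bar>cell_mass J f j - cell_mass J h j\<bar>)"
    by (rule L1_norm_histogram_diff[OF J])
  also have "\<dots> \<le> (\<Sum>j\<in>grid J. cell_mass J (\<lambda>x. \<bar>f x - h x\<bar>) j)"
  proof (rule sum_mono)
    fix j :: "nat ^ 'd"
    note ints = integrable_cell_mult[OF int(1), of J j] integrable_cell_mult[OF int(2), of J j]
    have "cell_mass J f j - cell_mass J h j
      = (LINT x|lebesgue_on unit_cube. indicator (cell J j) x * f x - indicator (cell J j) x * h x)"
      unfolding cell_mass_def using ints by simp
    also have "\<bar>\<dots>\<bar> \<le> (LINT x|lebesgue_on unit_cube. \<bar>indicator (cell J j) x * f x - indicator (cell J j) x * h x\<bar>)"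
      by (rule integral_abs_bound)
    also have "\<dots> = cell_mass J (\<lambda>x. \<bar>f x - h x\<bar>) j"
      unfolding cell_mass_def by (intro Bochner_Integration.integral_cong refl) (simp add: indicator_def)
    finally show "\<bar>cell_mass J f j - cell_mass J h j\<bar> \<le> cell_mass J (\<lambda>x. \<bar>f x - h x\<bar>) j" .
  qed
  also have "\<dots> = L1_norm (\<lambda>x. f x - h x)"
    unfolding L1_norm_def by (rule sum_cell_mass[OF J fh])
  finally show ?thesis .
qed

text \<open>
  Truncating \<open>f\<close> at a high level costs little by dominated convergence. A measurable function is an almost
  everywhere limit of continuous ones, and after the same truncation these are uniformly bounded, so that dominated
  convergence applies again on the cube.
\<close>

lemma L1_dense_continuous:
  fixes f :: "real ^ 'd \<Rightarrow> real"
  assumes int: "integrable (lebesgue_on unit_cube) f" and e: "0 < e"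
  obtains h where "continuous_on unit_cube h" "integrable (lebesgue_on unit_cube) h" "L1_norm (\<lambda>x. f x - h x) < e"
proof -
  let ?M = "lebesgue_on (unit_cube :: (real ^ 'd) set)"
  interpret finite_measure ?M
    by (rule finite_measure_cube)
  \<comment> \<open>Truncation at the levels -B and B.\<close>
  define cl where "cl = (\<lambda>B t :: real. max (- B) (min B t))"
  have cl: "\<bar>cl B t\<bar> \<le> B" "\<bar>cl B t\<bar> \<le> \<bar>t\<bar>" if "0 \<le> B" for B t
    using that by (auto simp: cl_def)
  have cl_cont: "continuous_on S (cl B)" for S B
    unfolding cl_def by (intro continuous_intros)
  have cl_meas: "(\<lambda>x. cl B (u x)) \<in> borel_measurable ?M" if "u \<in> borel_measurable ?M" for B u
    using that unfolding cl_def by measurable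
  have "(\<lambda>B. LINT x|?M. \<bar>f x - cl (real B) (f x)\<bar>) \<longlonglongrightarrow> (LINT x|?M. 0)"
  proof (rule integral_dominated_convergence[where w = "\<lambda>x. 2 * \<bar>f x\<bar>"])
    show "AE x in ?M. (\<lambda>B. \<bar>f x - cl (real B) (f x)\<bar>) \<longlonglongrightarrow> 0"
    proof (rule AE_I2)
      fix x
      have "\<forall>\<^sub>F B in sequentially. \<bar>f x - cl (real B) (f x)\<bar> = 0"
        using eventually_ge_at_top[of "nat \<lceil>\<bar>f x\<bar>\<rceil>"]
      proof eventually_elim
        case (elim B)
        then have "\<bar>f x\<bar> \<le> real B"
          by linarith
        then show ?case
          by (auto simp: cl_def)
      qed
      then show "(\<lambda>B. \<bar>f x - cl (real B) (f x)\<bar>) \<longlonglongrightarrow> 0"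
        by (rule tendsto_eventually)
    qed
    show "AE x in ?M. norm \<bar>f x - cl (real B) (f x)\<bar> \<le> 2 * \<bar>f x\<bar>" for B
      by (rule AE_I2) (use cl(2)[of "real B"] in \<open>auto intro: order_trans[OF abs_triangle_ineq4]\<close>)
    show "(\<lambda>x. \<bar>f x - cl (real B) (f x)\<bar>) \<in> borel_measurable ?M" for B
      using int cl_meas[of f "real B"] by (intro borel_measurable_abs borel_measurable_diff) auto
  qed (use int in auto)
  then have "\<forall>\<^sub>F B in sequentially. (LINT x|?M. \<bar>f x - cl (real B) (f x)\<bar>) < e / 2"
    using e by (intro order_tendstoD(2)[where y = 0]) auto
  then obtain B where B: "(LINT x|?M. \<bar>f x - cl (real B) (f x)\<bar>) < e / 2"
    by (auto simp: eventually_sequentially)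
  have "f measurable_on unit_cube"
    using int by (subst measurable_on_iff_borel_measurable) auto
  then obtain N u where N: "negligible N" and u: "\<And>n. continuous_on UNIV (u n)"
    and lim: "\<And>x. x \<notin> N \<Longrightarrow> (\<lambda>n. u n x) \<longlonglongrightarrow> (if x \<in> unit_cube then f x else 0)"
    unfolding measurable_on_def by blast
  let ?h = "\<lambda>n x. cl (real B) (u n x)"
  have h_cont: "continuous_on S (?h n)" for S n
    by (rule continuous_on_compose2[OF cl_cont[of UNIV]]) (use continuous_on_subset[OF u subset_UNIV] in auto)
  have h_meas: "?h n \<in> borel_measurable ?M" for n
    by (rule continuous_imp_measurable_on_sets_lebesgue[OF h_cont]) simp
  have h_int: "integrable ?M (?h n)" for n
    by (rule integrable_const_bound[where B = "real B", OF _ h_meas]) (simp add: cl)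
  have fB_int: "integrable ?M (\<lambda>x. cl (real B) (f x))"
    by (rule integrable_const_bound[where B = "real B", OF _ cl_meas]) (use int cl in auto)
  have "(\<lambda>n. LINT x|?M. \<bar>cl (real B) (f x) - ?h n x\<bar>) \<longlonglongrightarrow> (LINT x|?M. 0)"
  proof (rule integral_dominated_convergence[where w = "\<lambda>x. 2 * real B"])
    have "N \<in> null_sets lebesgue"
      using N by (simp add: negligible_iff_null_sets)
    then have "AE x in lebesgue. x \<notin> N"
      by (rule AE_not_in)
    then have "AE x in lebesgue. x \<in> unit_cube \<longrightarrow> (\<lambda>n. \<bar>cl (real B) (f x) - ?h n x\<bar>) \<longlonglongrightarrow> 0"
    proof eventually_elim
      case (elim x)
      show ?case
      proof
        assume "x \<in> unit_cube"
        then have "(\<lambda>n. u n x) \<longlonglongrightarrow> f x"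
          using lim[OF elim] by simp
        then have "(\<lambda>n. ?h n x) \<longlonglongrightarrow> cl (real B) (f x)"
          unfolding cl_def by (intro tendsto_intros)
        then have "(\<lambda>n. \<bar>cl (real B) (f x) - ?h n x\<bar>) \<longlonglongrightarrow> \<bar>cl (real B) (f x) - cl (real B) (f x)\<bar>"
          by (intro tendsto_intros)
        then show "(\<lambda>n. \<bar>cl (real B) (f x) - ?h n x\<bar>) \<longlonglongrightarrow> 0"
          by simp
      qed
    qed
    then show "AE x in ?M. (\<lambda>n. \<bar>cl (real B) (f x) - ?h n x\<bar>) \<longlonglongrightarrow> 0"
      by (subst AE_restrict_space_iff) auto
    show "AE x in ?M. norm \<bar>cl (real B) (f x) - ?h n x\<bar> \<le> 2 * real B" for n
    proof (rule AE_I2)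
      fix x
      have "\<bar>cl (real B) (f x)\<bar> \<le> real B" "\<bar>?h n x\<bar> \<le> real B"
        by (simp_all add: cl)
      then show "norm \<bar>cl (real B) (f x) - ?h n x\<bar> \<le> 2 * real B"
        by (simp add: abs_le_iff)
    qed
    show "(\<lambda>x. \<bar>cl (real B) (f x) - ?h n x\<bar>) \<in> borel_measurable ?M" for n
      using fB_int h_meas by (intro borel_measurable_abs borel_measurable_diff) auto
  qed auto
  then have "\<forall>\<^sub>F n in sequentially. (LINT x|?M. \<bar>cl (real B) (f x) - ?h n x\<bar>) < e / 2"
    using e by (intro order_tendstoD(2)[where y = 0]) auto
  then obtain n where n: "(LINT x|?M. \<bar>cl (real B) (f x) - ?h n x\<bar>) < e / 2"
    by (auto simp: eventually_sequentially)
  show ?thesis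
  proof (rule that[of "?h n"])
    show "L1_norm (\<lambda>x. f x - ?h n x) < e"
      using L1_norm_triangle[OF int fB_int h_int[of n]] B n by (simp add: L1_norm_def)
  qed (rule h_cont h_int)+
qed

text \<open>
  Cellwise averaging is an $L_1$-contraction, so convergence passes from continuous functions, where it follows from
  uniform continuity, to their $L_1$-limits.
\<close>

lemma L1_projection_tendsto:
  fixes f :: "real ^ 'd \<Rightarrow> real"
  assumes int: "integrable (lebesgue_on unit_cube) f" and e: "0 < e"
  shows "\<forall>\<^sub>F J in sequentially. L1_norm (\<lambda>x. f x - histogram J (cell_mass J f) x) < e"
proof -
  obtain h where h: "continuous_on unit_cube h" "integrable (lebesgue_on unit_cube) h"
    "L1_norm (\<lambda>x. f x - h x) < e / 3"
    using L1_dense_continuous[OF int, of "e / 3"] e by auto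
  have "uniformly_continuous_on unit_cube h"
    using h(1) by (intro compact_uniformly_continuous) (simp_all add: unit_cube_eq_cbox compact_cbox)
  then obtain d where d: "0 < d"
    "\<And>x y. x \<in> unit_cube \<Longrightarrow> y \<in> unit_cube \<Longrightarrow> dist y x < d \<Longrightarrow> dist (h y) (h x) < e / 3"
    using uniformly_continuous_onE[of unit_cube h "e / 3"] e by auto
  have "(\<lambda>J. real CARD('d) / real J) \<longlonglongrightarrow> 0"
    by (rule lim_const_over_n)
  then have "\<forall>\<^sub>F J in sequentially. real CARD('d) / real J < d"
    using d(1) by (rule order_tendstoD(2))
  then show ?thesis
    using eventually_gt_at_top[of 0]
  proof eventually_elim
    case (elim J)
    have "L1_norm (\<lambda>x. h x - histogram J (cell_mass J h) x) \<le> e / 3"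
    proof (rule L1_projection_uniform[OF elim(2) h(2)])
      fix x y :: "real ^ 'd"
      assume "x \<in> unit_cube" "y \<in> unit_cube" "norm (x - y) \<le> real CARD('d) / real J"
      then show "\<bar>h x - h y\<bar> \<le> e / 3"
        using d(2)[of y x] elim(1) by (simp add: dist_norm less_imp_le)
    qed
    moreover have "L1_norm (\<lambda>x. histogram J (cell_mass J h) x - histogram J (cell_mass J f) x) < e / 3"
      using L1_projection_contraction[OF elim(2) h(2) int] h(3) by (simp add: L1_norm_commute[of h])
    ultimately show ?case
      using L1_norm_triangle[OF int h(2) integrable_histogram[of J "cell_mass J f"]]
        L1_norm_triangle[OF h(2) integrable_histogram[of J "cell_mass J h"] integrable_histogram[of J "cell_mass J f"]] h(3)
      by linarith
  qed
qed

section \<open>Sampling error of the cell frequencies\<close>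

definition obs_law :: "(real ^ 'd \<Rightarrow> real) \<Rightarrow> (real ^ 'd) measure" where
  "obs_law g = density (lebesgue_on unit_cube) (\<lambda>x. ennreal (g x))"

lemma data_law_eq: "data_law n g = (\<Pi>\<^sub>M i\<in>{..<n}. obs_law g)"
  by (simp add: data_law_def obs_law_def)

lemma has_bochner_integral_obs_law:
  assumes g: "g \<in> densities" and h: "h \<in> borel_measurable (lebesgue_on unit_cube)"
    and int: "integrable (lebesgue_on unit_cube) (\<lambda>x. h x * g x)"
  shows "has_bochner_integral (obs_law g) h (LINT x|lebesgue_on unit_cube. h x * g x :: real)"
  unfolding obs_law_def
proof (rule has_bochner_integral_density[OF h])
  show "g \<in> borel_measurable (lebesgue_on unit_cube)" "AE x in lebesgue_on unit_cube. 0 \<le> g x"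
    using g by (auto simp: densities_def)
  show "has_bochner_integral (lebesgue_on unit_cube) (\<lambda>x. g x *\<^sub>R h x) (LINT x|lebesgue_on unit_cube. h x * g x)"
    using has_bochner_integral_integrable[OF int] by (simp add: mult.commute)
qed

lemma prob_space_obs_law:
  assumes g: "g \<in> densities"
  shows "prob_space (obs_law g)"
proof
  have "has_bochner_integral (obs_law g) (\<lambda>_. 1) (LINT x|lebesgue_on unit_cube. 1 * g x)"
    using g by (intro has_bochner_integral_obs_law) (auto simp: densities_def)
  then have "measure (obs_law g) (space (obs_law g)) = 1"
    using g by (simp add: has_bochner_integral_iff densities_def)
  then show "emeasure (obs_law g) (space (obs_law g)) = 1"
    by (metis Sigma_Algebra.measure_def enn2real_eq_posreal_iff ennreal_1 zero_less_one)
qed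

lemma AE_obs_law_cells:
  assumes g: "g \<in> densities" and J: "0 < J"
  shows "AE x in obs_law g. \<exists>j\<in>grid J. x \<in> cell J j"
  using AE_cube_cells[OF J] g unfolding obs_law_def
  by (subst AE_density) (auto simp: densities_def)

lemma (in prob_space) variance_iid_sum:
  fixes Y :: "'a \<Rightarrow> real" and n :: nat
  assumes meas: "Y \<in> borel_measurable M" and bd: "\<And>x. \<bar>Y x\<bar> \<le> B" and mean: "expectation Y = 0"
  defines "P \<equiv> \<Pi>\<^sub>M i\<in>{..<n}. M"
  shows "integrable P (\<lambda>X. (\<Sum>i<n. Y (X i))\<^sup>2)"
    and "(LINT X|P. (\<Sum>i<n. Y (X i))\<^sup>2) = real n * expectation (\<lambda>x. (Y x)\<^sup>2)"
proof -
  interpret prod: product_prob_space "\<lambda>_. M" "{..<n}"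
    by standard
  interpret P: prob_space P
    unfolding P_def by (rule prob_space_PiM) (rule prob_space_axioms)
  have Ym: "(\<lambda>X. Y (X i)) \<in> borel_measurable P" if "i < n" for i
  proof -
    have "(\<lambda>X. X i) \<in> P \<rightarrow>\<^sub>M M"
      unfolding P_def using that by (intro measurable_component_singleton) simp
    then show ?thesis
      by (rule measurable_compose[OF _ meas])
  qed
  have YY: "integrable P (\<lambda>X. Y (X i) * Y (X k))" if "i < n" "k < n" for i k
  proof (rule P.integrable_const_bound[where B = "B * B"])
    show "AE X in P. norm (Y (X i) * Y (X k)) \<le> B * B"
      using bd order_trans[OF abs_ge_zero bd] by (intro AE_I2) (auto simp: abs_mult intro!: mult_mono)
  qed (use Ym that in auto)
  have sq: "(\<Sum>i<n. Y (X i))\<^sup>2 = (\<Sum>i<n. \<Sum>k<n. Y (X i) * Y (X k))" for X :: "nat \<Rightarrow> 'a"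
    by (simp add: power2_eq_square sum_product)
  show "integrable P (\<lambda>X. (\<Sum>i<n. Y (X i))\<^sup>2)"
    unfolding sq by (intro Bochner_Integration.integrable_sum YY) auto
  have cov: "(LINT X|P. Y (X i) * Y (X k)) = (if i = k then expectation (\<lambda>x. (Y x)\<^sup>2) else 0)"
    if ik: "i < n" "k < n" for i k
  proof (cases "i = k")
    case True
    have "(LINT X|P. (Y (X i))\<^sup>2) = (LINT x|distr P M (\<lambda>X. X i). (Y x)\<^sup>2)"
      using ik meas unfolding P_def by (subst integral_distr) auto
    also have "distr P M (\<lambda>X. X i) = M"
      unfolding P_def using ik by (intro distr_PiM_component prob_space_axioms) auto
    finally show ?thesis
      using True by (simp add: power2_eq_square)
  next
    case False
    \<comment> \<open>The product of two distinct observations is a product over all coordinates with constant factors 1.\<close>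
    let ?f = "\<lambda>m. if m = i \<or> m = k then Y else (\<lambda>_. 1)"
    have Yi: "integrable M Y"
      using bd by (intro integrable_const_bound[where B = B] meas) auto
    have "Y (X i) * Y (X k) = (\<Prod>m<n. ?f m (X m))" for X :: "nat \<Rightarrow> 'a"
    proof -
      have "(\<Prod>m<n. ?f m (X m)) = (\<Prod>m\<in>{i, k}. ?f m (X m))"
        using ik by (intro prod.mono_neutral_right) auto
      then show ?thesis
        using False by simp
    qed
    then have "(LINT X|P. Y (X i) * Y (X k)) = (LINT X|P. (\<Prod>m<n. ?f m (X m)))"
      by simp
    also have "\<dots> = (\<Prod>m<n. expectation (?f m))"
      unfolding P_def using Yi by (intro prod.product_integral_prod) auto
    also have "\<dots> = 0"
      using ik mean by (intro prod_zero) auto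
    finally show ?thesis
      using False by simp
  qed
  have "(LINT X|P. (\<Sum>i<n. Y (X i))\<^sup>2) = (\<Sum>i<n. \<Sum>k<n. (LINT X|P. Y (X i) * Y (X k)))"
    unfolding sq using YY
    by (subst Bochner_Integration.integral_sum) (auto intro!: Bochner_Integration.integrable_sum sum.cong
        Bochner_Integration.integral_sum)
  also have "\<dots> = (\<Sum>i<n. \<Sum>k<n. if i = k then expectation (\<lambda>x. (Y x)\<^sup>2) else 0)"
    using cov by (intro sum.cong refl) auto
  also have "\<dots> = real n * expectation (\<lambda>x. (Y x)\<^sup>2)"
    by (simp add: sum.delta)
  finally show "(LINT X|P. (\<Sum>i<n. Y (X i))\<^sup>2) = real n * expectation (\<lambda>x. (Y x)\<^sup>2)" .
qed

lemma cell_frequency_deviation: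
  fixes g :: "real ^ 'd \<Rightarrow> real"
  assumes g: "g \<in> densities" and n: "0 < n"
  shows "integrable (data_law n g) (\<lambda>X. cell_count n J X j / real n - cell_mass J g j)"
    and "(LINT X|data_law n g. \<bar>cell_count n J X j / real n - cell_mass J g j\<bar>) \<le> sqrt (cell_mass J g j / real n)"
    and "0 \<le> cell_mass J g j"
proof -
  let ?D = "obs_law g" and ?I = "indicator (cell J j) :: real ^ 'd \<Rightarrow> real"
  interpret D: prob_space ?D
    by (rule prob_space_obs_law[OF g])
  interpret P: prob_space "data_law n g"
    unfolding data_law_eq by (rule prob_space_PiM) (rule D.prob_space_axioms)
  define p where "p = cell_mass J g j"
  define Y where "Y = (\<lambda>x. ?I x - p)"
  have gi: "integrable (lebesgue_on unit_cube) g"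
    using g by (simp add: densities_def)
  have "has_bochner_integral ?D ?I p"
    unfolding p_def cell_mass_def
    by (rule has_bochner_integral_obs_law[OF g measurable_indicator_cell integrable_cell_mult[OF gi]])
  then have I: "integrable ?D ?I" "D.expectation ?I = p"
    by (auto simp only: has_bochner_integral_iff)
  show p0: "0 \<le> cell_mass J g j"
    unfolding p_def[symmetric] I(2)[symmetric] by (rule Bochner_Integration.integral_nonneg) simp
  have Im: "?I \<in> borel_measurable ?D"
    using I(1) by (rule borel_measurable_integrable)
  then have Ym: "Y \<in> borel_measurable ?D"
    unfolding Y_def by (intro borel_measurable_diff) auto
  have bd: "\<bar>Y x\<bar> \<le> 1 + \<bar>p\<bar>" for x
    unfolding Y_def by (rule order_trans[OF abs_triangle_ineq4]) (simp add: indicator_def)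
  have mean: "D.expectation Y = 0"
    unfolding Y_def using I by (simp add: D.prob_space del: integral_indicator)
  have sqY: "(Y x)\<^sup>2 = (1 - 2 * p) * ?I x + p\<^sup>2" for x
    by (simp add: Y_def indicator_def power2_eq_square algebra_simps)
  have "D.expectation (\<lambda>x. (Y x)\<^sup>2) = (1 - 2 * p) * p + p\<^sup>2"
    unfolding sqY using I by (simp add: D.prob_space del: integral_indicator)
  also have "\<dots> \<le> p"
    by (simp add: power2_eq_square algebra_simps)
  finally have var: "D.expectation (\<lambda>x. (Y x)\<^sup>2) \<le> p" .
  have mean_dev: "cell_count n J X j / real n - p = (\<Sum>i<n. Y (X i)) / real n" for X
    using n by (simp add: cell_count_def Y_def sum_subtractf field_simps)
  note iid = D.variance_iid_sum[OF Ym bd mean, of n, folded data_law_eq]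
  have sq_int: "integrable (data_law n g) (\<lambda>X. (cell_count n J X j / real n - p)\<^sup>2)"
    unfolding mean_dev power_divide using iid(1) by simp
  have "(LINT X|data_law n g. (cell_count n J X j / real n - p)\<^sup>2) = real n * D.expectation (\<lambda>x. (Y x)\<^sup>2) / (real n)\<^sup>2"
    unfolding mean_dev power_divide using iid(2) by simp
  also have "\<dots> = D.expectation (\<lambda>x. (Y x)\<^sup>2) / real n"
    using n by (simp add: power2_eq_square)
  also have "\<dots> \<le> p / real n"
    using var by (rule divide_right_mono) simp
  finally have sq_le: "(LINT X|data_law n g. (cell_count n J X j / real n - p)\<^sup>2) \<le> p / real n" .
  have "(\<lambda>X. \<Sum>i<n. Y (X i)) \<in> borel_measurable (data_law n g)"
  proof (rule borel_measurable_sum)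
    fix i assume "i \<in> {..<n}"
    then have "(\<lambda>X. X i) \<in> data_law n g \<rightarrow>\<^sub>M ?D"
      unfolding data_law_eq by (rule measurable_component_singleton)
    then show "(\<lambda>X. Y (X i)) \<in> borel_measurable (data_law n g)"
      by (rule measurable_compose[OF _ Ym])
  qed
  then have m: "(\<lambda>X. cell_count n J X j / real n - p) \<in> borel_measurable (data_law n g)"
    unfolding mean_dev by (rule borel_measurable_divide) simp
  from P.expectation_abs_le_sqrt[OF m sq_int sq_le]
  show "integrable (data_law n g) (\<lambda>X. cell_count n J X j / real n - cell_mass J g j)"
    "(LINT X|data_law n g. \<bar>cell_count n J X j / real n - cell_mass J g j\<bar>) \<le> sqrt (cell_mass J g j / real n)"
    by (simp_all add: p_def)
qed

definition total_deviation :: "nat \<Rightarrow> nat \<Rightarrow> (real ^ 'd \<Rightarrow> real) \<Rightarrow> (nat \<Rightarrow> real ^ 'd) \<Rightarrow> real" where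
  "total_deviation n J g X = (\<Sum>j\<in>grid J. \<bar>cell_count n J X j / real n - cell_mass J g j\<bar>)"

lemma total_deviation_bound:
  fixes g :: "real ^ 'd \<Rightarrow> real"
  assumes g: "g \<in> densities" and n: "0 < n" and J: "0 < J"
  shows "integrable (data_law n g) (total_deviation n J g)"
    and "(LINT X|data_law n g. total_deviation n J g X) \<le> sqrt (real J ^ CARD('d) / real n)"
proof -
  note dev = cell_frequency_deviation[OF g n, of J]
  show "integrable (data_law n g) (total_deviation n J g)"
    unfolding total_deviation_def[abs_def] using dev(1)
    by (intro Bochner_Integration.integrable_sum integrable_abs)
  have "(LINT X|data_law n g. total_deviation n J g X)
    = (\<Sum>j\<in>grid J. (LINT X|data_law n g. \<bar>cell_count n J X j / real n - cell_mass J g j\<bar>))"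
    unfolding total_deviation_def using dev(1) by (intro Bochner_Integration.integral_sum integrable_abs)
  also have "\<dots> \<le> (\<Sum>j\<in>grid J. sqrt (cell_mass J g j / real n))"
    by (intro sum_mono dev(2))
  also have "\<dots> \<le> sqrt (real (card (grid J :: (nat ^ 'd) set)) * (\<Sum>j\<in>grid J. cell_mass J g j / real n))"
    using dev(3) by (intro sum_sqrt_le) auto
  also have "(\<Sum>j\<in>grid J. cell_mass J g j / real n) = 1 / real n"
    using sum_cell_mass[OF J, of g] g by (simp add: densities_def sum_divide_distrib[symmetric])
  finally show "(LINT X|data_law n g. total_deviation n J g X) \<le> sqrt (real J ^ CARD('d) / real n)"
    by (simp add: card_grid)
qed

text \<open>
  The counts add up to $n$ only almost surely, because no cell contains the points of the cube that have some
  coordinate equal to zero and lie outside the first cell.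
\<close>

lemma AE_total_count:
  fixes g :: "real ^ 'd \<Rightarrow> real"
  assumes g: "g \<in> densities" and J: "0 < J"
  shows "AE X in data_law n g. (\<Sum>j\<in>grid J. cell_count n J X j) = real n"
proof -
  have "AE X in data_law n g. \<exists>j\<in>grid J. X i \<in> cell J j" if "i < n" for i
    unfolding data_law_eq using that
    by (intro AE_PiM_component prob_space_obs_law[OF g] AE_obs_law_cells[OF g J]) auto
  then have "AE X in data_law n g. \<forall>i\<in>{..<n}. \<exists>j\<in>grid J. X i \<in> cell J (j :: nat ^ 'd)"
    by (subst AE_ball_countable) auto
  then show ?thesis
  proof eventually_elim
    case (elim X)
    have "(\<Sum>j\<in>grid J. cell_count n J X j) = (\<Sum>i<n. \<Sum>j\<in>grid J. indicator (cell J j) (X i))"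
      unfolding cell_count_def by (rule sum.swap)
    also have "\<dots> = (\<Sum>i<n. 1)"
    proof (rule sum.cong[OF refl])
      fix i assume "i \<in> {..<n}"
      then obtain j where j: "j \<in> grid J" "X i \<in> cell J j"
        using elim by blast
      show "(\<Sum>j\<in>grid J. indicator (cell J j) (X i)) = (1 :: real)"
        using sum_cells_in_cell[OF J j, of "\<lambda>_. 1"] by simp
    qed
    finally show ?case
      by simp
  qed
qed

section \<open>Error bounds of the test for a fixed sample size\<close>

text \<open>
  The posterior mean $(a_j + N_j) / (A + n)$ differs from the frequency $N_j / n$ by at most
  $a_j / n + N_j A / n^2$, and these bounds sum to $2A/n$.
\<close>

lemma posterior_tail:
  fixes X :: "nat \<Rightarrow> real ^ 'd"
  assumes n: "0 < n" and J: "0 < J" and a: "\<And>j. j \<in> grid J \<Longrightarrow> 0 < a j" and t: "0 < t"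
    and N: "(\<Sum>j\<in>grid J. cell_count n J X j) = real n"
  shows "measure (posterior n J a X) {\<theta>\<in>space (posterior n J a X). t \<le> (\<Sum>j\<in>grid J. \<bar>\<theta> j - cell_mass J g j\<bar>)}
    \<le> (sqrt (real J ^ CARD('d) / real n) + 2 * (\<Sum>j\<in>grid J. a j) / real n + total_deviation n J g X) / t"
proof -
  define A where "A = (\<Sum>j\<in>(grid J :: (nat ^ 'd) set). a j)"
  let ?N = "cell_count n J X"
  let ?b = "\<lambda>j. a j + ?N j"
  have N0: "0 \<le> ?N j" for j
    by (auto simp: cell_count_def intro: sum_nonneg)
  have b: "0 < ?b j" if "j \<in> grid J" for j
    using a[OF that] N0[of j] by linarith
  have A0: "0 \<le> A"
    unfolding A_def using a by (intro sum_nonneg) (auto intro: less_imp_le)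
  have B: "(\<Sum>j\<in>grid J. ?b j) = A + real n"
    by (simp add: sum.distrib N A_def)
  have "measure (posterior n J a X) {\<theta>\<in>space (posterior n J a X). t \<le> (\<Sum>j\<in>grid J. \<bar>\<theta> j - cell_mass J g j\<bar>)}
    \<le> (sqrt (real (card (grid J :: (nat ^ 'd) set)) / (A + real n)) + (\<Sum>j\<in>grid J. \<bar>?b j / (A + real n) - cell_mass J g j\<bar>)) / t"
    using dirichlet_tail[where a = ?b and I = "grid J" and q = "cell_mass J g", OF finite_grid b one_in_grid[OF J] t]
    unfolding posterior_def B by simp
  also have "\<dots> \<le> (sqrt (real J ^ CARD('d) / real n) + 2 * A / real n + total_deviation n J g X) / t"
  proof (rule divide_right_mono)
    have "real J ^ CARD('d) / (A + real n) \<le> real J ^ CARD('d) / real n"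
      using A0 n by (intro divide_left_mono) auto
    then have root: "sqrt (real (card (grid J :: (nat ^ 'd) set)) / (A + real n)) \<le> sqrt (real J ^ CARD('d) / real n)"
      by (simp add: card_grid)
    have "(\<Sum>j\<in>grid J. \<bar>?b j / (A + real n) - cell_mass J g j\<bar>)
      \<le> (\<Sum>j\<in>grid J. a j / real n + ?N j * (A / (real n * real n)) + \<bar>?N j / real n - cell_mass J g j\<bar>)"
    proof (rule sum_mono)
      fix j :: "nat ^ 'd" assume j: "j \<in> grid J"
      have "A / (real n * (A + real n)) = 1 / real n - 1 / (A + real n)"
        using A0 n by (simp add: field_simps)
      then have "?b j / (A + real n) - ?N j / real n = a j / (A + real n) - ?N j * (A / (real n * (A + real n)))"
        by (simp add: add_divide_distrib right_diff_distrib)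
      moreover have "a j / (A + real n) \<le> a j / real n" "0 \<le> a j / (A + real n)"
        using A0 n a[OF j] by (auto intro!: divide_left_mono)
      moreover have "?N j * (A / (real n * (A + real n))) \<le> ?N j * (A / (real n * real n))"
        "0 \<le> ?N j * (A / (real n * (A + real n)))"
        using A0 n N0[of j] by (auto intro!: mult_left_mono divide_left_mono)
      ultimately show "\<bar>?b j / (A + real n) - cell_mass J g j\<bar>
        \<le> a j / real n + ?N j * (A / (real n * real n)) + \<bar>?N j / real n - cell_mass J g j\<bar>"
        by (smt (verit))
    qed
    also have "\<dots> = 2 * A / real n + total_deviation n J g X"
    proof -
      have "A / real n + real n * (A / (real n * real n)) = 2 * A / real n"
        using n by simp
      then show ?thesis
        by (simp only: sum.distrib sum_divide_distrib[symmetric] sum_distrib_right[symmetric] N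
            total_deviation_def A_def)
    qed
    finally show "sqrt (real (card (grid J :: (nat ^ 'd) set)) / (A + real n))
        + (\<Sum>j\<in>grid J. \<bar>?b j / (A + real n) - cell_mass J g j\<bar>)
      \<le> sqrt (real J ^ CARD('d) / real n) + 2 * A / real n + total_deviation n J g X"
      using add_mono[OF root] by (simp add: add.assoc)
  qed (use t in simp)
  finally show ?thesis
    by (simp add: A_def)
qed

text \<open>
  One square root bounds the spread of the posterior around its mean, the other one the sampling error of the cell
  frequencies; the last term is the pull of the prior.
\<close>

definition risk_bound :: "nat \<Rightarrow> nat \<Rightarrow> (nat ^ 'd \<Rightarrow> real) \<Rightarrow> real" where
  "risk_bound n J a = 2 * sqrt (real J ^ CARD('d) / real n) + 2 * (\<Sum>j\<in>grid J. a j) / real n"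

text \<open>
  The common core of both error bounds: whenever the decision \<open>\<psi>\<close> is wrong, the posterior puts mass at
  least \<open>c\<close> on weights that are \<open>t\<close> away from the true cell masses. The integral of a function that is
  not integrable is $0$ by convention, so dominating \<open>\<psi>\<close> by an integrable nonnegative function bounds its
  expectation without an analysis of how the posterior depends on the sample.
\<close>

lemma E0_le_risk_bound:
  fixes g :: "real ^ 'd \<Rightarrow> real"
  assumes g: "g \<in> densities" and n: "0 < n" and J: "0 < J" and a: "\<And>j. j \<in> grid J \<Longrightarrow> 0 < a j"
    and t: "0 < t" and c: "0 < c"
    and \<psi>: "\<And>X. \<psi> X \<noteq> 0 \<Longrightarrow> \<psi> X = 1 \<and> c \<le> measure (posterior n J a X)
      {\<theta>\<in>space (posterior n J a X). t \<le> (\<Sum>j\<in>grid J. \<bar>\<theta> j - cell_mass J g j\<bar>)}"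
  shows "E0 n g \<psi> \<le> risk_bound n J a / (t * c)"
proof -
  interpret P: prob_space "data_law n g"
    unfolding data_law_eq by (rule prob_space_PiM) (rule prob_space_obs_law[OF g])
  let ?k = "sqrt (real J ^ CARD('d) / real n) + 2 * (\<Sum>j\<in>grid J. a j) / real n"
  have "0 \<le> (\<Sum>j\<in>grid J. a j)"
    using a by (intro sum_nonneg) (auto intro: less_imp_le)
  then have k: "0 \<le> ?k"
    by simp
  have h0: "0 \<le> (?k + total_deviation n J g X) / (t * c)" for X
    using k t c by (auto simp: total_deviation_def intro!: divide_nonneg_nonneg add_nonneg_nonneg sum_nonneg)
  note dev = total_deviation_bound[OF g n J]
  have "E0 n g \<psi> \<le> (LINT X|data_law n g. (?k + total_deviation n J g X) / (t * c))"
    unfolding E0_def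
  proof (rule integral_mono_AE')
    show "AE X in data_law n g. \<psi> X \<le> (?k + total_deviation n J g X) / (t * c)"
      using AE_total_count[OF g J]
    proof eventually_elim
      case (elim X)
      show ?case
      proof (cases "\<psi> X = 0")
        case True
        then show ?thesis
          using h0 by simp
      next
        case False
        then have "\<psi> X * c \<le> (?k + total_deviation n J g X) / t"
          using \<psi>[OF False] posterior_tail[where a = a and g = g, OF n J a t elim] by simp
        then show ?thesis
          using c t by (simp add: field_simps)
      qed
    qed
    show "AE X in data_law n g. 0 \<le> (?k + total_deviation n J g X) / (t * c)"
      using h0 by simp
    show "integrable (data_law n g) (\<lambda>X. (?k + total_deviation n J g X) / (t * c))"
      using dev(1) by simp
  qed
  also have "\<dots> = (?k + (LINT X|data_law n g. total_deviation n J g X)) / (t * c)"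
    using dev(1) by (simp add: P.prob_space)
  also have "\<dots> \<le> risk_bound n J a / (t * c)"
    using dev(2) t c unfolding risk_bound_def by (intro divide_right_mono) auto
  finally show ?thesis .
qed

lemma posterior_prob_space:
  assumes J: "0 < J" and a: "\<And>j. j \<in> grid J \<Longrightarrow> 0 < a j"
  shows "prob_space (posterior n J a X)"
proof -
  have "0 < a j + cell_count n J X j" if "j \<in> grid J" for j
    using a[OF that] by (intro add_pos_nonneg) (auto simp: cell_count_def intro: sum_nonneg)
  then show ?thesis
    unfolding posterior_def by (intro prob_space_dirichlet finite_grid one_in_grid J)
qed

lemma sets_posterior [measurable_cong]: "sets (posterior n J a X) = sets (\<Pi>\<^sub>M j\<in>grid J. borel)"
  unfolding posterior_def by (rule sets_dirichlet)

text \<open>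
  A rejection means that the posterior puts mass more than $1 - \gamma$ on histograms at distance more than
  \<open>r\<close> from the decreasing functions. The averaged true density is within \<open>\<beta>\<close> of them, so
  these histograms are at distance at least \<open>r - \<beta>\<close> from it.
\<close>

lemma false_rejection_le:
  fixes g :: "real ^ 'd \<Rightarrow> real"
  assumes g: "g \<in> densities" "g \<in> Fstar" and n: "0 < n" and J: "0 < J" and a: "\<And>j. j \<in> grid J \<Longrightarrow> 0 < a j"
    and \<gamma>: "\<gamma> < 1"
    and \<beta>: "L1_norm (\<lambda>x. g x - histogram J (cell_mass J g) x) \<le> \<beta>" "\<beta> < r"
  shows "E0 n g (mono_test n J a r \<gamma>) \<le> risk_bound n J a / ((r - \<beta>) * (1 - \<gamma>))"
proof (rule E0_le_risk_bound[OF g(1) n J a])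
  fix X assume "mono_test n J a r \<gamma> X \<noteq> 0"
  then have rej: "posterior_prob n J a X {h. d1 h Fstar \<le> r} < \<gamma>" and one: "mono_test n J a r \<gamma> X = 1"
    by (auto simp: mono_test_def)
  let ?P = "posterior n J a X"
  interpret P: prob_space ?P
    by (rule posterior_prob_space[OF J a])
  have ev: "{\<theta> \<in> space ?P. d1 (histogram J \<theta> :: real ^ 'd \<Rightarrow> real) Fstar \<le> r} \<in> sets ?P"
    using d1_histogram_measurable[OF J, where 'd = 'd] by measurable
  have tail: "{\<theta> \<in> space ?P. r - \<beta> \<le> (\<Sum>j\<in>grid J. \<bar>\<theta> j - cell_mass J g j\<bar>)} \<in> sets ?P"
    by measurable
  have "1 - \<gamma> \<le> 1 - P.prob {\<theta> \<in> space ?P. d1 (histogram J \<theta> :: real ^ 'd \<Rightarrow> real) Fstar \<le> r}"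
    using rej by (simp add: posterior_prob_def)
  also have "\<dots> = P.prob (space ?P - {\<theta> \<in> space ?P. d1 (histogram J \<theta> :: real ^ 'd \<Rightarrow> real) Fstar \<le> r})"
    by (rule P.prob_compl[OF ev, symmetric])
  also have "\<dots> \<le> P.prob {\<theta> \<in> space ?P. r - \<beta> \<le> (\<Sum>j\<in>grid J. \<bar>\<theta> j - cell_mass J g j\<bar>)}"
  proof (rule P.finite_measure_mono[OF _ tail])
    have "d1 (histogram J \<theta> :: real ^ 'd \<Rightarrow> real) Fstar \<le> (\<Sum>j\<in>grid J. \<bar>\<theta> j - cell_mass J g j\<bar>) + \<beta>" for \<theta> :: "nat ^ 'd \<Rightarrow> real"
      using d1_Fstar_triangle[OF integrable_histogram integrable_histogram, of J \<theta> J "cell_mass J g"]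
        L1_norm_histogram_diff[OF J, of \<theta> "cell_mass J g"]
        d1_le[OF g(2), of "histogram J (cell_mass J g)"] \<beta>(1)
      by (simp add: L1_norm_commute[of g])
    then show "space ?P - {\<theta> \<in> space ?P. d1 (histogram J \<theta> :: real ^ 'd \<Rightarrow> real) Fstar \<le> r}
      \<subseteq> {\<theta> \<in> space ?P. r - \<beta> \<le> (\<Sum>j\<in>grid J. \<bar>\<theta> j - cell_mass J g j\<bar>)}"
      by (auto simp: not_le diff_le_eq intro: order_trans[OF less_imp_le])
  qed
  finally show "mono_test n J a r \<gamma> X = 1 \<and> 1 - \<gamma> \<le> measure ?P
      {\<theta> \<in> space ?P. r - \<beta> \<le> (\<Sum>j\<in>grid J. \<bar>\<theta> j - cell_mass J g j\<bar>)}"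
    using one by blast
qed (use \<gamma> \<beta> in auto)

text \<open>
  An acceptance means that the posterior puts mass at least $\gamma$ on histograms within \<open>r\<close> of the
  decreasing functions. The averaged true density is at distance at least \<open>r + t\<close> from them, so these
  histograms are at distance at least \<open>t\<close> from it.
\<close>

lemma false_acceptance_le:
  fixes g :: "real ^ 'd \<Rightarrow> real"
  assumes g: "g \<in> densities" and n: "0 < n" and J: "0 < J" and a: "\<And>j. j \<in> grid J \<Longrightarrow> 0 < a j"
    and \<gamma>: "0 < \<gamma>"
    and sep: "L1_norm (\<lambda>x. g x - histogram J (cell_mass J g) x) + r + t \<le> d1 g Fstar" and t: "0 < t"
  shows "E0 n g (\<lambda>X. 1 - mono_test n J a r \<gamma> X) \<le> risk_bound n J a / (t * \<gamma>)"
proof (rule E0_le_risk_bound[OF g n J a t \<gamma>])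
  fix X assume "1 - mono_test n J a r \<gamma> X \<noteq> 0"
  then have acc: "\<gamma> \<le> posterior_prob n J a X {h. d1 h Fstar \<le> r}" and one: "1 - mono_test n J a r \<gamma> X = 1"
    by (auto simp: mono_test_def)
  let ?P = "posterior n J a X"
  interpret P: prob_space ?P
    by (rule posterior_prob_space[OF J a])
  have tail: "{\<theta> \<in> space ?P. t \<le> (\<Sum>j\<in>grid J. \<bar>\<theta> j - cell_mass J g j\<bar>)} \<in> sets ?P"
    by measurable
  have gi: "integrable (lebesgue_on unit_cube) g"
    using g by (simp add: densities_def)
  have "\<gamma> \<le> P.prob {\<theta> \<in> space ?P. d1 (histogram J \<theta> :: real ^ 'd \<Rightarrow> real) Fstar \<le> r}"
    using acc by (simp add: posterior_prob_def)
  also have "\<dots> \<le> P.prob {\<theta> \<in> space ?P. t \<le> (\<Sum>j\<in>grid J. \<bar>\<theta> j - cell_mass J g j\<bar>)}"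
  proof (rule P.finite_measure_mono[OF _ tail])
    have le: "t + r \<le> (\<Sum>j\<in>grid J. \<bar>\<theta> j - cell_mass J g j\<bar>) + d1 (histogram J \<theta> :: real ^ 'd \<Rightarrow> real) Fstar" for \<theta> :: "nat ^ 'd \<Rightarrow> real"
      using d1_Fstar_triangle[OF gi integrable_histogram, of J "cell_mass J g"]
        d1_Fstar_triangle[OF integrable_histogram integrable_histogram, of J "cell_mass J g" J \<theta>]
        L1_norm_histogram_diff[OF J, of "cell_mass J g" \<theta>] sep
      by (simp add: abs_minus_commute)
    show "{\<theta> \<in> space ?P. d1 (histogram J \<theta> :: real ^ 'd \<Rightarrow> real) Fstar \<le> r}
      \<subseteq> {\<theta> \<in> space ?P. t \<le> (\<Sum>j\<in>grid J. \<bar>\<theta> j - cell_mass J g j\<bar>)}"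
    proof
      fix \<theta> assume "\<theta> \<in> {\<theta> \<in> space ?P. d1 (histogram J \<theta> :: real ^ 'd \<Rightarrow> real) Fstar \<le> r}"
      then show "\<theta> \<in> {\<theta> \<in> space ?P. t \<le> (\<Sum>j\<in>grid J. \<bar>\<theta> j - cell_mass J g j\<bar>)}"
        using le[of \<theta>] by simp
    qed
  qed
  finally show "1 - mono_test n J a r \<gamma> X = 1 \<and> \<gamma> \<le> measure ?P
      {\<theta> \<in> space ?P. t \<le> (\<Sum>j\<in>grid J. \<bar>\<theta> j - cell_mass J g j\<bar>)}"
    using one by blast
qed

section \<open>Asymptotics\<close>

lemma tendsto_zero_if_eventually_le:
  fixes u b :: "nat \<Rightarrow> real"
  assumes "b \<longlonglongrightarrow> 0" "\<And>n. 0 \<le> u n" "\<forall>\<^sub>F n in sequentially. u n \<le> b n"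
  shows "u \<longlonglongrightarrow> 0"
  by (rule tendsto_sandwich[OF _ assms(3) tendsto_const assms(1)]) (simp add: assms(2))

lemma SUP_tendsto_zero_if_eventually_le:
  fixes b :: "nat \<Rightarrow> real"
  assumes "b \<longlonglongrightarrow> 0" "\<forall>\<^sub>F n in sequentially. \<forall>g\<in>S n. u n g \<le> b n"
  shows "(\<lambda>n. SUP g\<in>S n. ennreal (u n g)) \<longlonglongrightarrow> 0"
proof (rule tendsto_sandwich[where f = "\<lambda>_. 0" and h = "\<lambda>n. ennreal (b n)"])
  show "\<forall>\<^sub>F n in sequentially. (SUP g\<in>S n. ennreal (u n g)) \<le> ennreal (b n)"
    using assms(2) by eventually_elim (auto intro!: SUP_least ennreal_leI)
  show "(\<lambda>n. ennreal (b n)) \<longlonglongrightarrow> 0"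
    using tendsto_ennrealI[OF assms(1)] by simp
qed auto

lemma L1_projection_holder:
  fixes g :: "real ^ 'd \<Rightarrow> real"
  assumes g: "g \<in> densities" "g \<in> holder \<alpha> L" and J: "0 < J" and \<alpha>: "0 < \<alpha>" and L: "0 < L"
  shows "L1_norm (\<lambda>x. g x - histogram J (cell_mass J g) x) \<le> L * (real CARD('d) / real J) powr \<alpha>"
proof (rule L1_projection_uniform[OF J])
  show "integrable (lebesgue_on unit_cube) g"
    using g by (simp add: densities_def)
  fix x y :: "real ^ 'd"
  assume xy: "x \<in> unit_cube" "y \<in> unit_cube" "norm (x - y) \<le> real CARD('d) / real J"
  have "\<bar>g x - g y\<bar> \<le> L * norm (x - y) powr \<alpha>"
    using g(2) xy by (simp add: holder_def)
  also have "\<dots> \<le> L * (real CARD('d) / real J) powr \<alpha>"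
    using xy \<alpha> L by (intro mult_left_mono powr_mono2) auto
  finally show "\<bar>g x - g y\<bar> \<le> L * (real CARD('d) / real J) powr \<alpha>" .
qed

lemma E0_mono_test_nonneg:
  "0 \<le> E0 n g (mono_test n J a r \<gamma>)" "0 \<le> E0 n g (\<lambda>X. 1 - mono_test n J a r \<gamma> X)"
  by (auto simp: E0_def mono_test_def intro!: Bochner_Integration.integral_nonneg)

theorem theorem3p2:
  fixes J :: "nat \<Rightarrow> nat"
    and a :: "nat \<Rightarrow> nat ^ 'd \<Rightarrow> real"
    and M :: "nat \<Rightarrow> real"
    and \<gamma> :: real
    and \<epsilon> :: "nat \<Rightarrow> real"
    and \<phi> :: "nat \<Rightarrow> (nat \<Rightarrow> real ^ 'd) \<Rightarrow> real"
  defines "\<epsilon> \<equiv> \<lambda>n. real n powr (- 1 / (2 + real CARD('d)))"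
  defines "\<phi> \<equiv> \<lambda>n. mono_test n (J n) (a n) (M n * \<epsilon> n) \<gamma>"
  assumes J_pos: "\<And>n. 0 < J n"
    and J_order: "(\<lambda>n. real (J n)) \<in> \<Theta>(\<lambda>n. real n powr (1 / (2 + real CARD('d))))"
    and a_pos: "\<And>n j. j \<in> grid (J n) \<Longrightarrow> 0 < a n j"
    and a_mass: "(\<lambda>n. (\<Sum>j\<in>grid (J n). a n j) / real n) \<in> o(\<lambda>n. M n * \<epsilon> n)"
    and M_lim: "filterlim M at_top sequentially"
    and M_slow: "\<And>\<delta>. 0 < \<delta> \<Longrightarrow> M \<in> o(\<lambda>n. real n powr \<delta>)"
    and \<gamma>: "0 < \<gamma>" "\<gamma> < 1"
  shows "(\<forall>g0\<in>Gstar. (\<lambda>n. E0 n g0 (\<phi> n)) \<longlonglongrightarrow> 0)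
    \<and> (\<forall>g0\<in>densities - L1_closure Gstar. (\<lambda>n. E0 n g0 (\<lambda>X. 1 - \<phi> n X)) \<longlonglongrightarrow> 0)
    \<and> (\<forall>\<alpha> L. 0 < \<alpha> \<and> \<alpha> < 1 \<and> 0 < L \<longrightarrow>
         (\<exists>C>0. (\<lambda>n. SUP g0 \<in> {g0 \<in> densities \<inter> holder \<alpha> L.
                       d1 g0 Gstar > C * real n powr (- \<alpha> / (2 + real CARD('d)))}.
                     ennreal (E0 n g0 (\<lambda>X. 1 - \<phi> n X))) \<longlonglongrightarrow> 0))
    \<and> (\<forall>L C. 0 < L \<and> 2 < C \<longrightarrow>
         (\<lambda>n. SUP g0 \<in> {g0 \<in> densities \<inter> holder 1 L. d1 g0 Gstar > C * M n * \<epsilon> n}.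
                     ennreal (E0 n g0 (\<lambda>X. 1 - \<phi> n X))) \<longlonglongrightarrow> 0)"
proof -
  define d where "d = real CARD('d)"
  define R where "R = (\<lambda>n. risk_bound n (J n) (a n))"
  define \<rho> where "\<rho> = (\<lambda>n. R n / (M n * \<epsilon> n))"
  have d: "0 < d"
    by (simp add: d_def)
  have \<epsilon>_eq: "\<epsilon> n = real n powr (- 1 / (2 + d))" for n
    by (simp add: \<epsilon>_def d_def)
  have \<epsilon>_pos: "0 < \<epsilon> n" if "0 < n" for n
    using that by (simp add: \<epsilon>_eq)
  have M_ge: "\<forall>\<^sub>F n in sequentially. c \<le> M n" for c
    using M_lim by (simp add: filterlim_at_top)
  obtain c1 where c1: "0 < c1" "\<forall>\<^sub>F n in sequentially. c1 * real n powr (1 / (2 + d)) \<le> real (J n)"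
    using landau_omega.bigE[OF bigthetaD2[OF J_order]] by (auto simp: d_def)
  obtain c2 where c2: "0 < c2" "\<forall>\<^sub>F n in sequentially. real (J n) \<le> c2 * real n powr (1 / (2 + d))"
    using landau_o.bigE[OF bigthetaD1[OF J_order]] by (auto simp: d_def)
  have inv_J: "\<forall>\<^sub>F n in sequentially. 1 / real (J n) \<le> \<epsilon> n / c1"
    using c1(2) eventually_gt_at_top[of 0]
  proof eventually_elim
    case (elim n)
    have "1 / real (J n) \<le> 1 / (c1 * real n powr (1 / (2 + d)))"
      using elim c1(1) by (intro divide_left_mono) (auto simp: J_pos)
    also have "\<dots> = \<epsilon> n / c1"
      by (simp add: \<epsilon>_eq powr_minus_divide mult.commute)
    finally show ?case .
  qed
  have J_lim: "filterlim J at_top sequentially"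
  proof -
    have "filterlim (\<lambda>n. c1 * real n powr (1 / (2 + d))) at_top sequentially"
      using c1(1) d by real_asymp
    then have "filterlim (\<lambda>n. real (J n)) at_top sequentially"
      by (rule filterlim_at_top_mono[OF _ c1(2)])
    then show ?thesis
      by (simp add: filterlim_sequentially_iff_filterlim_real)
  qed
  \<comment> \<open>The choice of J balances the two errors: J^d / n and 1 / J^2 are both of the order of the square of \<open>\<epsilon> n\<close>.\<close>
  have root: "\<forall>\<^sub>F n in sequentially. sqrt (real (J n) ^ CARD('d) / real n) \<le> sqrt (c2 ^ CARD('d)) * \<epsilon> n"
    using c2(2) eventually_gt_at_top[of 0]
  proof eventually_elim
    case (elim n)
    have "real (J n) ^ CARD('d) / real n \<le> (c2 * real n powr (1 / (2 + d))) ^ CARD('d) / real n"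
      using elim by (intro divide_right_mono power_mono) auto
    also have "\<dots> = c2 ^ CARD('d) * (real n powr (d / (2 + d)) / real n powr 1)"
      using elim by (simp add: power_mult_distrib powr_power d_def)
    also have "real n powr (d / (2 + d)) / real n powr 1 = real n powr (- 2 / (2 + d))"
      using d by (subst powr_diff[symmetric]) (simp add: field_simps)
    also have "\<dots> = (\<epsilon> n)\<^sup>2"
      using elim by (simp add: \<epsilon>_eq powr_power)
    finally have "sqrt (real (J n) ^ CARD('d) / real n) \<le> sqrt (c2 ^ CARD('d) * (\<epsilon> n)\<^sup>2)"
      by simp
    then show ?case
      using \<epsilon>_pos[of n] elim by (simp add: real_sqrt_mult)
  qed
  have r_pos: "\<forall>\<^sub>F n in sequentially. 0 < M n * \<epsilon> n"
    using M_ge[of 1] eventually_gt_at_top[of 0] by eventually_elim (auto simp: \<epsilon>_pos)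
  have R_nonneg: "0 \<le> R n" for n
  proof -
    have "0 \<le> (\<Sum>j\<in>grid (J n). a n j)"
      using a_pos by (intro sum_nonneg) (auto intro: less_imp_le)
    then show ?thesis
      by (simp add: R_def risk_bound_def)
  qed
  have \<rho>_lim: "\<rho> \<longlonglongrightarrow> 0"
  proof (rule tendsto_sandwich[where f = "\<lambda>_. 0"])
    let ?b = "\<lambda>n. 2 * sqrt (c2 ^ CARD('d)) / M n + 2 * ((\<Sum>j\<in>grid (J n). a n j) / real n / (M n * \<epsilon> n))"
    show "\<forall>\<^sub>F n in sequentially. 0 \<le> \<rho> n"
      using r_pos by eventually_elim (auto simp: \<rho>_def R_nonneg)
    show "\<forall>\<^sub>F n in sequentially. \<rho> n \<le> ?b n"
      using r_pos root eventually_gt_at_top[of 0]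
    proof eventually_elim
      case (elim n)
      have "\<rho> n \<le> (2 * (sqrt (c2 ^ CARD('d)) * \<epsilon> n) + 2 * ((\<Sum>j\<in>grid (J n). a n j) / real n)) / (M n * \<epsilon> n)"
        unfolding \<rho>_def R_def risk_bound_def using elim by (intro divide_right_mono) auto
      also have "\<dots> = ?b n"
        using \<epsilon>_pos[OF elim(3)] by (simp add: add_divide_distrib)
      finally show ?case .
    qed
    have "(\<lambda>n. 2 * sqrt (c2 ^ CARD('d)) / M n) \<longlonglongrightarrow> 0"
      using M_lim by (rule real_tendsto_divide_at_top[OF tendsto_const])
    from tendsto_add[OF this tendsto_mult_left[OF smalloD_tendsto[OF a_mass], of 2]]
    show "?b \<longlonglongrightarrow> 0"
      by simp
  qed simp
  have r_lim: "(\<lambda>n. M n * \<epsilon> n) \<longlonglongrightarrow> 0"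
  proof -
    have "(\<lambda>n. M n / real n powr (1 / (2 + d))) \<longlonglongrightarrow> 0"
      using d by (intro smalloD_tendsto M_slow) auto
    then show ?thesis
      by (simp add: \<epsilon>_eq powr_minus_divide)
  qed
  have accept: "E0 n g (\<lambda>X. 1 - \<phi> n X) \<le> \<rho> n / (\<kappa> * \<gamma>)"
    if "g \<in> densities" "0 < n" "0 < M n * \<epsilon> n" "0 < \<kappa>"
      "L1_norm (\<lambda>x. g x - histogram (J n) (cell_mass (J n) g) x) + M n * \<epsilon> n + \<kappa> * (M n * \<epsilon> n) \<le> d1 g Fstar" for n \<kappa> g
  proof -
    have "E0 n g (\<lambda>X. 1 - \<phi> n X) \<le> risk_bound n (J n) (a n) / (\<kappa> * (M n * \<epsilon> n) * \<gamma>)"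
      unfolding \<phi>_def using that by (intro false_acceptance_le J_pos a_pos \<gamma>) auto
    also have "\<dots> = \<rho> n / (\<kappa> * \<gamma>)"
      by (simp add: \<rho>_def R_def)
    finally show ?thesis .
  qed

  have part1: "(\<lambda>n. E0 n g0 (\<phi> n)) \<longlonglongrightarrow> 0" if g0: "g0 \<in> Gstar" for g0
  proof (rule tendsto_zero_if_eventually_le)
    have dens: "g0 \<in> densities" "g0 \<in> Fstar"
      using g0 integrable_Fstar[of g0] by (auto simp: Gstar_def densities_def)
    define k where "k = d * (g0 0 - g0 1)"
    have k: "0 \<le> k"
    proof -
      have "(1 :: real ^ 'd) \<in> unit_cube"
        by (simp add: unit_cube_def)
      then show ?thesis
        using Fstar_bounds(2)[OF dens(2)] d by (simp add: k_def)
    qed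
    show "(\<lambda>n. 2 * \<rho> n / (1 - \<gamma>)) \<longlonglongrightarrow> 0"
      using tendsto_divide[OF tendsto_mult_left[OF \<rho>_lim, of 2] tendsto_const[of "1 - \<gamma>"]] \<gamma> by simp
    show "\<forall>\<^sub>F n in sequentially. E0 n g0 (\<phi> n) \<le> 2 * \<rho> n / (1 - \<gamma>)"
      using inv_J M_ge[of "2 * k / c1"] r_pos eventually_gt_at_top[of 0]
    proof eventually_elim
      case (elim n)
      have "L1_norm (\<lambda>x. g0 x - histogram (J n) (cell_mass (J n) g0) x) \<le> k * (1 / real (J n))"
        using L1_projection_Fstar[OF dens(2) J_pos] by (simp add: k_def d_def)
      also have "\<dots> \<le> k * (\<epsilon> n / c1)"
        using elim(1) k by (intro mult_left_mono)
      also have "\<dots> = 2 * k / c1 * \<epsilon> n / 2"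
        by simp
      also have "\<dots> \<le> M n * \<epsilon> n / 2"
        using elim(2) \<epsilon>_pos[OF elim(4)] by (intro divide_right_mono mult_right_mono) auto
      finally have "E0 n g0 (\<phi> n) \<le> risk_bound n (J n) (a n) / ((M n * \<epsilon> n - M n * \<epsilon> n / 2) * (1 - \<gamma>))"
        unfolding \<phi>_def using elim \<gamma> dens by (intro false_rejection_le J_pos a_pos) auto
      also have "\<dots> = 2 * \<rho> n / (1 - \<gamma>)"
        by (simp add: \<rho>_def R_def)
      finally show ?case .
    qed
  qed (simp add: \<phi>_def E0_mono_test_nonneg)

  have part2: "(\<lambda>n. E0 n g0 (\<lambda>X. 1 - \<phi> n X)) \<longlonglongrightarrow> 0" if g0: "g0 \<in> densities - L1_closure Gstar" for g0
  proof (rule tendsto_zero_if_eventually_le)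
    have int: "integrable (lebesgue_on unit_cube) g0"
      using g0 by (simp add: densities_def)
    obtain e where e: "0 < e" "\<And>s. s \<in> Gstar \<Longrightarrow> e \<le> L1_norm (\<lambda>x. g0 x - s x)"
      using g0 int by (auto simp: L1_closure_def not_less)
    have "e \<le> d1 g0 Gstar"
      using Gstar_nonempty by (intro d1_greatest e(2)) auto
    \<comment> \<open>Bias, tolerance and posterior spread each take at most e / 8 of this gap.\<close>
    then have sep: "e / 2 \<le> d1 g0 Fstar"
      using d1_Gstar_le[of g0] g0 by simp
    have "\<forall>\<^sub>F n in sequentially. L1_norm (\<lambda>x. g0 x - histogram (J n) (cell_mass (J n) g0) x) < e / 8"
      using e(1) by (intro eventually_compose_filterlim[OF L1_projection_tendsto[OF int] J_lim]) simp
    moreover have "\<forall>\<^sub>F n in sequentially. M n * \<epsilon> n < e / 8"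
      using e(1) by (intro order_tendstoD(2)[OF r_lim]) simp
    ultimately show "\<forall>\<^sub>F n in sequentially. E0 n g0 (\<lambda>X. 1 - \<phi> n X) \<le> \<rho> n / (1 * \<gamma>)"
      using r_pos eventually_gt_at_top[of 0]
    proof eventually_elim
      case (elim n)
      then show ?case
        using g0 sep by (intro accept) auto
    qed
    show "(\<lambda>n. \<rho> n / (1 * \<gamma>)) \<longlonglongrightarrow> 0"
      using tendsto_divide[OF \<rho>_lim tendsto_const[of \<gamma>]] \<gamma> by simp
  qed (simp add: \<phi>_def E0_mono_test_nonneg)

  have bias: "\<forall>\<^sub>F n in sequentially. \<forall>g :: real ^ 'd \<Rightarrow> real \<in> densities \<inter> holder \<alpha> L.
      L1_norm (\<lambda>x. g x - histogram (J n) (cell_mass (J n) g) x) \<le> L * (d / c1) powr \<alpha> * real n powr (- \<alpha> / (2 + d))"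
    if \<alpha>: "0 < \<alpha>" and L: "0 < L" for \<alpha> L
    using inv_J eventually_gt_at_top[of 0]
  proof eventually_elim
    case (elim n)
    have "d / real (J n) = d * (1 / real (J n))"
      by simp
    also have "\<dots> \<le> d * (\<epsilon> n / c1)"
      using elim d by (intro mult_left_mono) auto
    finally have "(d / real (J n)) powr \<alpha> \<le> (d / c1 * \<epsilon> n) powr \<alpha>"
      using \<alpha> d by (intro powr_mono2) auto
    also have "\<dots> = (d / c1) powr \<alpha> * \<epsilon> n powr \<alpha>"
      using d c1(1) \<epsilon>_pos[OF elim(2)] by (simp only: powr_mult)
    also have "\<epsilon> n powr \<alpha> = real n powr (- \<alpha> / (2 + d))"
      by (simp add: \<epsilon>_eq powr_powr)
    finally have le: "L * (d / real (J n)) powr \<alpha> \<le> L * (d / c1) powr \<alpha> * real n powr (- \<alpha> / (2 + d))"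
      using L by simp
    show ?case
    proof
      fix g :: "real ^ 'd \<Rightarrow> real" assume "g \<in> densities \<inter> holder \<alpha> L"
      then show "L1_norm (\<lambda>x. g x - histogram (J n) (cell_mass (J n) g) x)
          \<le> L * (d / c1) powr \<alpha> * real n powr (- \<alpha> / (2 + d))"
        using L1_projection_holder[OF _ _ J_pos[of n] \<alpha> L, of g] le by (simp add: d_def)
    qed
  qed

  have part3: "\<exists>C>0. (\<lambda>n. SUP g0 \<in> {g0 \<in> densities \<inter> holder \<alpha> L.
                       d1 g0 Gstar > C * real n powr (- \<alpha> / (2 + real CARD('d)))}.
                     ennreal (E0 n g0 (\<lambda>X. 1 - \<phi> n X))) \<longlonglongrightarrow> 0"
    if \<alpha>: "0 < \<alpha>" "\<alpha> < 1" and L: "0 < L" for \<alpha> L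
  proof -
    \<comment> \<open>In the constant 2 * (K + 1), K pays for the bias, 1 for tolerance and posterior spread, which are of smaller
      order than the separation when \<open>\<alpha> < 1\<close>, and the factor 2 for passing from densities to functions.\<close>
    define K where "K = L * (d / c1) powr \<alpha>"
    have K: "0 \<le> K"
      using L by (simp add: K_def)
    have slow: "\<forall>\<^sub>F n in sequentially. 2 * (M n * \<epsilon> n) \<le> real n powr (- \<alpha> / (2 + d))"
    proof -
      have "0 < (1 - \<alpha>) / (2 + d)"
        using \<alpha> d by simp
      from landau_o.smallD[OF M_slow[OF this], of "1 / 2"]
      have "\<forall>\<^sub>F n in sequentially. \<bar>M n\<bar> \<le> 1 / 2 * real n powr ((1 - \<alpha>) / (2 + d))"
        by simp
      then show ?thesis
        using eventually_gt_at_top[of 0]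
      proof eventually_elim
        case (elim n)
        have "2 * (M n * \<epsilon> n) \<le> real n powr ((1 - \<alpha>) / (2 + d)) * \<epsilon> n"
          using elim(1) \<epsilon>_pos[OF elim(2)] by (simp add: mult.assoc[symmetric])
        also have "\<dots> = real n powr (- \<alpha> / (2 + d))"
          by (simp add: \<epsilon>_eq powr_add[symmetric] diff_divide_distrib)
        finally show ?case .
      qed
    qed
    have "(\<lambda>n. SUP g0 \<in> {g0 \<in> densities \<inter> holder \<alpha> L.
                       d1 g0 Gstar > 2 * (K + 1) * real n powr (- \<alpha> / (2 + real CARD('d)))}.
                     ennreal (E0 n g0 (\<lambda>X. 1 - \<phi> n X))) \<longlonglongrightarrow> 0"
    proof (rule SUP_tendsto_zero_if_eventually_le)
      show "(\<lambda>n. \<rho> n / (1 * \<gamma>)) \<longlonglongrightarrow> 0"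
        using tendsto_divide[OF \<rho>_lim tendsto_const[of \<gamma>]] \<gamma> by simp
      show "\<forall>\<^sub>F n in sequentially. \<forall>g\<in>{g0 \<in> densities \<inter> holder \<alpha> L.
          d1 g0 Gstar > 2 * (K + 1) * real n powr (- \<alpha> / (2 + real CARD('d)))}.
        E0 n g (\<lambda>X. 1 - \<phi> n X) \<le> \<rho> n / (1 * \<gamma>)"
        using bias[OF \<alpha>(1) L] slow r_pos eventually_gt_at_top[of 0]
      proof eventually_elim
        case (elim n)
        show ?case
        proof
          fix g :: "real ^ 'd \<Rightarrow> real" assume "g \<in> {g0 \<in> densities \<inter> holder \<alpha> L.
            d1 g0 Gstar > 2 * (K + 1) * real n powr (- \<alpha> / (2 + real CARD('d)))}"
          then have g: "g \<in> densities" "g \<in> holder \<alpha> L" "2 * ((K + 1) * real n powr (- \<alpha> / (2 + d))) < d1 g Gstar"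
            by (simp_all only: mem_Collect_eq Int_iff d_def mult.assoc)
          have "(K + 1) * real n powr (- \<alpha> / (2 + d)) \<le> d1 g Fstar"
            using d1_Gstar_le[OF g(1)] g(3) by linarith
          moreover have "L1_norm (\<lambda>x. g x - histogram (J n) (cell_mass (J n) g) x) \<le> K * real n powr (- \<alpha> / (2 + d))"
            using elim(1) g by (simp add: K_def)
          ultimately show "E0 n g (\<lambda>X. 1 - \<phi> n X) \<le> \<rho> n / (1 * \<gamma>)"
            using elim g by (intro accept) (auto simp: distrib_right)
        qed
      qed
    qed
    moreover have "0 < 2 * (K + 1)"
      using K by simp
    ultimately show ?thesis
      by blast
  qed

  have part4: "(\<lambda>n. SUP g0 \<in> {g0 \<in> densities \<inter> holder 1 L. d1 g0 Gstar > C * M n * \<epsilon> n}.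
                     ennreal (E0 n g0 (\<lambda>X. 1 - \<phi> n X))) \<longlonglongrightarrow> 0"
    if L: "0 < L" and C: "2 < C" for L C
  proof (rule SUP_tendsto_zero_if_eventually_le)
    define K where "K = L * (d / c1) powr 1"
    \<comment> \<open>The separation from all decreasing functions is C / 2 times the tolerance; its surplus over the tolerance is
      divided evenly between the bias and the posterior spread.\<close>
    define \<kappa> where "\<kappa> = (C - 2) / 4"
    have \<kappa>: "0 < \<kappa>" "C / 2 = 1 + 2 * \<kappa>"
      using C by (simp_all add: \<kappa>_def field_simps)
    show "(\<lambda>n. \<rho> n / (\<kappa> * \<gamma>)) \<longlonglongrightarrow> 0"
      using tendsto_divide[OF \<rho>_lim tendsto_const[of "\<kappa> * \<gamma>"]] \<gamma> \<kappa> by simp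
    show "\<forall>\<^sub>F n in sequentially. \<forall>g\<in>{g0 \<in> densities \<inter> holder 1 L. d1 g0 Gstar > C * M n * \<epsilon> n}.
        E0 n g (\<lambda>X. 1 - \<phi> n X) \<le> \<rho> n / (\<kappa> * \<gamma>)"
      using bias[OF zero_less_one L] M_ge[of "K / \<kappa>"] r_pos eventually_gt_at_top[of 0]
    proof eventually_elim
      case (elim n)
      have "K * \<epsilon> n = K / \<kappa> * (\<kappa> * \<epsilon> n)"
        using \<kappa> by simp
      also have "\<dots> \<le> M n * (\<kappa> * \<epsilon> n)"
        using elim(2) \<epsilon>_pos[OF elim(4)] \<kappa> by (intro mult_right_mono) auto
      finally have K\<epsilon>: "K * \<epsilon> n \<le> \<kappa> * (M n * \<epsilon> n)"
        by (simp add: mult_ac)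
      show ?case
      proof
        fix g :: "real ^ 'd \<Rightarrow> real" assume g: "g \<in> {g0 \<in> densities \<inter> holder 1 L. d1 g0 Gstar > C * M n * \<epsilon> n}"
        have "C / 2 * (M n * \<epsilon> n) \<le> d1 g Fstar"
          using d1_Gstar_le[of g] g by (simp add: mult.assoc)
        moreover have "L1_norm (\<lambda>x. g x - histogram (J n) (cell_mass (J n) g) x) \<le> K * \<epsilon> n"
          using elim(1) g by (simp add: K_def \<epsilon>_eq)
        ultimately show "E0 n g (\<lambda>X. 1 - \<phi> n X) \<le> \<rho> n / (\<kappa> * \<gamma>)"
          using elim g \<kappa>(1) K\<epsilon> unfolding \<kappa>(2) by (intro accept) (auto simp: distrib_right)
      qed
    qed
  qed

  show ?thesis
    using part1 part2 part3 part4 by blast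
qed

end
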